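(* Let $G$ be a connected simple graph of order $n\geq 3$, and let $\overline{G}$ denote its complement. Then $\lambda_3(G)=n-3$ if and only if $\overline{G}$ is one of the following: (i) $\overline{G}=rP_2\cup (n-2r)K_1$ for some integer $r$ with $2\leq r\leq \lfloor n/2\rfloor$; (ii) $\overline{G}=P_4\cup sP_2\cup (n-2s-4)K_1$ for some integer $s$ with $0\leq s\leq \lfloor (n-4)/2\rfloor$; (iii) $\overline{G}=P_3\cup tP_2\cup (n-2t-3)K_1$ for some integer $t$ with $0\leq t\leq \lfloor (n-3)/2\rfloor$; (iv) $\overline{G}=C_3\cup tP_2\cup (n-2t-3)K_1$ for some integer $t$ with $0\leq t\leq \lfloor (n-3)/2\rfloor$.
   Context: All graphs are finite, undirected and simple. $P_m$ is the path on $m$ vertices, $C_3$ the triangle, $K_1$ a single vertex; $mH$ is the disjoint union of $m$ copies of $H$ and $\cup$ denotes disjoint union. For $S\subseteq V(G)$ with $|S|\geq 2$, an $S$-tree is a subgraph of $G$ that is a tree containing all vertices of $S$; $\lambda(S)$ is the maximum number of pairwise edge-disjoint $S$-trees in $G$. For $2\leq k\leq n$, $\lambda_k(G)=\min\{\lambda(S): S\subseteq V(G),\ |S|=k\}$, and $\lambda_k(G)=0$ if $G$ is disconnected. *)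

theory Defs
  imports Main
begin

text \<open>A graph is a pair of a vertex set and a set of edges, an edge being the set of its two ends.\<close>

type_synonym 'a ugraph = "'a set \<times> 'a set set"

abbreviation verts :: "'a ugraph \<Rightarrow> 'a set" where
  "verts G \<equiv> fst G"

abbreviation edges :: "'a ugraph \<Rightarrow> 'a set set" where
  "edges G \<equiv> snd G"

definition simple_graph :: "'a ugraph \<Rightarrow> bool" where
  "simple_graph G \<longleftrightarrow> finite (verts G) \<and> (\<forall>e\<in>edges G. e \<subseteq> verts G \<and> card e = 2)"

definition subgraph :: "'a ugraph \<Rightarrow> 'a ugraph \<Rightarrow> bool" where
  "subgraph H G \<longleftrightarrow> simple_graph H \<and> verts H \<subseteq> verts G \<and> edges H \<subseteq> edges G"

definition connected_graph :: "'a ugraph \<Rightarrow> bool" where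
  "connected_graph G \<longleftrightarrow> verts G \<noteq> {} \<and>
     (\<forall>u\<in>verts G. \<forall>v\<in>verts G. (u, v) \<in> {(x, y). {x, y} \<in> edges G}\<^sup>*)"

text \<open>A cycle is given by the list of its vertices in cyclic order.\<close>

definition is_cycle :: "'a ugraph \<Rightarrow> 'a list \<Rightarrow> bool" where
  "is_cycle G vs \<longleftrightarrow> length vs \<ge> 3 \<and> distinct vs \<and> set vs \<subseteq> verts G \<and>
     (\<forall>i<length vs. {vs ! i, vs ! (Suc i mod length vs)} \<in> edges G)"

definition tree_graph :: "'a ugraph \<Rightarrow> bool" where
  "tree_graph G \<longleftrightarrow> simple_graph G \<and> connected_graph G \<and> (\<nexists>vs. is_cycle G vs)"

definition steiner_tree :: "'a ugraph \<Rightarrow> 'a set \<Rightarrow> 'a ugraph \<Rightarrow> bool" where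
  "steiner_tree G S T \<longleftrightarrow> subgraph T G \<and> tree_graph T \<and> S \<subseteq> verts T"

text \<open>If \<open>S\<close> has at least two elements, every \<open>S\<close>-tree has an edge, so edge-disjoint
  \<open>S\<close>-trees are distinct and a family of them may be taken to be a set.\<close>

definition tree_packing :: "'a ugraph \<Rightarrow> 'a set \<Rightarrow> 'a ugraph set \<Rightarrow> bool" where
  "tree_packing G S \<T> \<longleftrightarrow> (\<forall>T\<in>\<T>. steiner_tree G S T) \<and>
     (\<forall>T\<in>\<T>. \<forall>T'\<in>\<T>. T \<noteq> T' \<longrightarrow> edges T \<inter> edges T' = {})"

definition local_lambda :: "'a ugraph \<Rightarrow> 'a set \<Rightarrow> nat" where
  "local_lambda G S = Max {card \<T> |\<T>. tree_packing G S \<T>}"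

definition gen_lambda :: "nat \<Rightarrow> 'a ugraph \<Rightarrow> nat" where
  "gen_lambda k G =
     (if connected_graph G then Min {local_lambda G S |S. S \<subseteq> verts G \<and> card S = k} else 0)"

definition complement :: "'a ugraph \<Rightarrow> 'a ugraph" where
  "complement G = (verts G, {e. e \<subseteq> verts G \<and> card e = 2} - edges G)"

definition graph_iso :: "'a ugraph \<Rightarrow> 'b ugraph \<Rightarrow> bool" (infix \<open>\<simeq>\<^sub>g\<close> 50) where
  "G \<simeq>\<^sub>g H \<longleftrightarrow> (\<exists>f. bij_betw f (verts G) (verts H) \<and>
     (\<forall>u\<in>verts G. \<forall>v\<in>verts G. {u, v} \<in> edges G \<longleftrightarrow> {f u, f v} \<in> edges H))"

definition path_graph :: "nat \<Rightarrow> nat ugraph" where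
  "path_graph m = ({..<m}, {{i, Suc i} |i. Suc i < m})"

text \<open>This is the cycle on \<open>m\<close> vertices only for \<open>m \<ge> 3\<close>.\<close>

definition cycle_graph :: "nat \<Rightarrow> nat ugraph" where
  "cycle_graph m = ({..<m}, {{i, Suc i mod m} |i. i < m})"

definition complete_graph :: "nat \<Rightarrow> nat ugraph" where
  "complete_graph m = ({..<m}, {e. e \<subseteq> {..<m} \<and> card e = 2})"

definition disjoint_union :: "'a ugraph \<Rightarrow> 'b ugraph \<Rightarrow> ('a + 'b) ugraph" (infixr \<open>\<union>\<^sub>g\<close> 65) where
  "G \<union>\<^sub>g H = (verts G <+> verts H, (`) Inl ` edges G \<union> (`) Inr ` edges H)"

definition copies :: "nat \<Rightarrow> 'a ugraph \<Rightarrow> (nat \<times> 'a) ugraph" (infixr \<open>\<cdot>\<^sub>g\<close> 70) where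
  "m \<cdot>\<^sub>g H = ({..<m} \<times> verts H, {Pair i ` e |i e. i < m \<and> e \<in> edges H})"

text \<open>The maximum and the minimum above are taken over finite nonempty sets.\<close>

lemma finite_steiner_trees:
  assumes "simple_graph G"
  shows "finite {T. steiner_tree G S T}"
proof (rule finite_subset)
  show "{T. steiner_tree G S T} \<subseteq> Pow (verts G) \<times> Pow (Pow (verts G))"
  proof
    fix T assume "T \<in> {T. steiner_tree G S T}"
    then have "verts T \<subseteq> verts G" "edges T \<subseteq> Pow (verts G)"
      unfolding steiner_tree_def subgraph_def simple_graph_def by blast+
    then show "T \<in> Pow (verts G) \<times> Pow (Pow (verts G))"
      by (simp add: mem_Times_iff)
  qed
  show "finite (Pow (verts G) \<times> Pow (Pow (verts G)))"
    using assms by (simp add: simple_graph_def)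
qed

lemma local_lambda_well_defined:
  assumes "simple_graph G"
  shows "finite {card \<T> |\<T>. tree_packing G S \<T>}" and "{card \<T> |\<T>. tree_packing G S \<T>} \<noteq> {}"
proof -
  have "{card \<T> |\<T>. tree_packing G S \<T>} \<subseteq> card ` Pow {T. steiner_tree G S T}"
    by (auto simp: tree_packing_def)
  then show "finite {card \<T> |\<T>. tree_packing G S \<T>}"
    using finite_steiner_trees[OF assms] by (meson finite_Pow_iff finite_imageI finite_subset)
  have "tree_packing G S {}"
    by (simp add: tree_packing_def)
  then show "{card \<T> |\<T>. tree_packing G S \<T>} \<noteq> {}"
    by blast
qed

lemma gen_lambda_well_defined:
  assumes "simple_graph G" and "k \<le> card (verts G)"
  shows "finite {local_lambda G S |S. S \<subseteq> verts G \<and> card S = k}"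
    and "{local_lambda G S |S. S \<subseteq> verts G \<and> card S = k} \<noteq> {}"
proof -
  have "{local_lambda G S |S. S \<subseteq> verts G \<and> card S = k} \<subseteq> local_lambda G ` Pow (verts G)"
    by auto
  then show "finite {local_lambda G S |S. S \<subseteq> verts G \<and> card S = k}"
    using assms(1) by (meson finite_Pow_iff finite_imageI finite_subset simple_graph_def)
  obtain S where "S \<subseteq> verts G" "card S = k"
    using assms(2) by (meson obtain_subset_with_card_n)
  then show "{local_lambda G S |S. S \<subseteq> verts G \<and> card S = k} \<noteq> {}"
    by blast
qed

end

theory Submission
  imports Defs
begin

text \<open>
  Let \<open>H\<close> be the complement of \<open>G\<close>. Together the four families are exactly the graphs \<open>H\<close> with at
  least two edges in which every degree is at most \<open>2\<close> and any two vertices of degree \<open>2\<close> are adjacent.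

  Upper bounds: a packing has at most as many trees as any \<open>u \<in> S\<close> has edges. If \<open>u, v \<in> S\<close> are
  adjacent, both of degree at most \<open>d\<close>, and \<open>S\<close> has a third vertex, then there are fewer than \<open>d\<close> trees:
  otherwise \<open>u\<close> and \<open>v\<close> are leaves of every tree, and the tree containing the edge \<open>uv\<close> is just this edge.

  Lower bounds: a vertex outside \<open>S\<close> that is adjacent to all of \<open>S\<close> is the centre of a star. The few
  other outer vertices, together with the edges inside \<open>S\<close>, are distributed over equally many trees
  by hand, one more if \<open>H\<close> has at most one edge.
\<close>

section \<open>Steiner trees and packings\<close>

text \<open>The number \<open>n - 3\<close> counts the vertices outside a triple \<open>S\<close>,
  so the lower bound asks for one tree per outer vertex. An outer vertex that misses one member of
  \<open>S\<close> still joins the other two, and an edge inside \<open>S\<close> can attach the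
  missed one. The obstacle is that such vertices may outnumber the inner edges: an independent
  triple of the complement can be missed by four outer vertices, while it has three inner edges. In
  these cases two inner edges form a tree of their own and some outer vertex serves as a bridge for
  others; the degree conditions on \<open>H\<close> provide the edges between outer vertices that
  this needs.

  The four families arise because the vertices of degree two in \<open>H\<close> form a clique, and
  each has only two neighbours. So there are at most three of them: three make up a C3, two are the
  middle of a P4, one is the middle of a P3, and none leaves a matching. Everything else consists of
  disjoint edges and isolated vertices.\<close>

lemma tree_graph_single: "tree_graph ({v}, {})"
proof -
  have "\<not> is_cycle ({v}, {}) vs" for vs
    by (cases vs) (auto simp: is_cycle_def)
  then show ?thesis
    by (auto simp: tree_graph_def simple_graph_def connected_graph_def)
qed

lemma sym_edge_rel: "sym {(x, y). {x, y} \<in> E}"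
  by (auto simp: sym_def insert_commute)

text \<open>A cycle through \<open>w\<close> needs two distinct neighbours of \<open>w\<close>, but
  \<open>{u, w}\<close> is the only edge there; any other cycle lies in the old tree.\<close>

lemma tree_graph_add_leaf:
  assumes T: "tree_graph (V, E)" and u: "u \<in> V" and w: "w \<notin> V"
  shows "tree_graph (insert w V, insert {u, w} E)"
proof -
  have fin: "finite V" and E: "\<And>e. e \<in> E \<Longrightarrow> e \<subseteq> V \<and> card e = 2"
    and conn: "\<And>x y. x \<in> V \<Longrightarrow> y \<in> V \<Longrightarrow> (x, y) \<in> {(x, y). {x, y} \<in> E}\<^sup>*"
    and acyc: "\<And>vs. \<not> is_cycle (V, E) vs"
    using T by (auto simp: tree_graph_def simple_graph_def connected_graph_def)
  have uw: "u \<noteq> w" using u w by auto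
  let ?R = "{(x, y). {x, y} \<in> insert {u, w} E}"
  have simple: "simple_graph (insert w V, insert {u, w} E)"
    using fin E u uw by (auto simp: simple_graph_def)
  have sub: "{(x, y). {x, y} \<in> E}\<^sup>* \<subseteq> ?R\<^sup>*"
    by (rule rtrancl_mono) auto
  have to_u: "(x, u) \<in> ?R\<^sup>*" if "x \<in> insert w V" for x
  proof (cases "x = w")
    case True
    then show ?thesis by (auto simp: insert_commute)
  next
    case False
    then show ?thesis using conn[of x u] that u sub by blast
  qed
  have from_u: "(u, x) \<in> ?R\<^sup>*" if "x \<in> insert w V" for x
    using to_u[OF that] sym_rtrancl[OF sym_edge_rel] by (metis symE)
  have "connected_graph (insert w V, insert {u, w} E)"
    using rtrancl_trans[OF to_u from_u] by (auto simp: connected_graph_def)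
  moreover have "\<not> is_cycle (insert w V, insert {u, w} E) vs" for vs
  proof
    assume cyc: "is_cycle (insert w V, insert {u, w} E) vs"
    let ?n = "length vs"
    have n: "?n \<ge> 3" and dist: "distinct vs" and sub: "set vs \<subseteq> insert w V"
      and edge: "\<And>i. i < ?n \<Longrightarrow> {vs ! i, vs ! (Suc i mod ?n)} \<in> insert {u, w} E"
      using cyc by (auto simp: is_cycle_def)
    show False
    proof (cases "w \<in> set vs")
      case False
      then have "{vs ! i, vs ! (Suc i mod ?n)} \<in> E" if "i < ?n" for i
      proof -
        have "Suc i mod ?n < ?n" using that by (intro mod_less_divisor) (cases vs, auto)
        then have "vs ! i \<noteq> w" "vs ! (Suc i mod ?n) \<noteq> w"
          using False that nth_mem by metis+
        then show ?thesis using edge[OF that] by (auto simp: doubleton_eq_iff)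
      qed
      then have "is_cycle (V, E) vs"
        using n dist sub False by (auto simp: is_cycle_def)
      then show False using acyc by blast
    next
      case True
      then obtain i where i: "i < ?n" "vs ! i = w" by (metis in_set_conv_nth)
      have Suc_mod: "Suc i mod ?n < ?n" using n by (intro mod_less_divisor) auto
      \<comment> \<open>\<open>j\<close> and \<open>k\<close> are the cyclic successor and
        predecessor of \<open>i\<close>; they differ since a cycle has at least three
        vertices.\<close>
      define j where "j = Suc i mod ?n"
      define k where "k = (if i = 0 then ?n - 1 else i - 1)"
      have jk: "j < ?n" "k < ?n" "Suc k mod ?n = i"
        using n i Suc_mod by (auto simp: j_def k_def)
      have "j \<noteq> k" "j \<noteq> i" "k \<noteq> i"
        using n i by (auto simp: j_def k_def mod_Suc split: if_splits)
      then have ne: "vs ! j \<noteq> vs ! k" "vs ! j \<noteq> w" "vs ! k \<noteq> w"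
        using dist i jk by (auto simp: nth_eq_iff_index_eq)
      have "{w, vs ! j} \<in> insert {u, w} E" "{vs ! k, w} \<in> insert {u, w} E"
        using edge[of i] edge[of k] i jk by (auto simp: j_def)
      then have "vs ! j = u" "vs ! k = u"
        using E w ne by (auto simp: doubleton_eq_iff)
      then show False using ne by simp
    qed
  qed
  ultimately show ?thesis using simple by (auto simp: tree_graph_def)
qed

text \<open>A pair \<open>(p, c)\<close> attaches the new leaf \<open>c\<close> to \<open>p\<close>.\<close>

definition grown :: "'a \<Rightarrow> ('a \<times> 'a) list \<Rightarrow> 'a ugraph" where
  "grown v ps = (insert v (snd ` set ps), (\<lambda>(p, c). {p, c}) ` set ps)"

text \<open>Simplification evaluates this on explicit lists, so the trees made by hand below need no
  separate argument for connectedness or acyclicity.\<close>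

fun growable :: "'a set \<Rightarrow> ('a \<times> 'a) list \<Rightarrow> bool" where
  "growable V [] = True"
| "growable V ((p, c) # ps) = (p \<in> V \<and> c \<notin> V \<and> growable (insert c V) ps)"

lemma tree_graph_grown_aux:
  "tree_graph (V, E) \<Longrightarrow> growable V ps \<Longrightarrow>
   tree_graph (V \<union> snd ` set ps, E \<union> (\<lambda>(p, c). {p, c}) ` set ps)"
proof (induction V ps arbitrary: E rule: growable.induct)
  case (2 V p c ps)
  then show ?case using tree_graph_add_leaf[of V E p c] by fastforce
qed simp

lemma tree_graph_grown: "growable {v} ps \<Longrightarrow> tree_graph (grown v ps)"
  using tree_graph_grown_aux[OF tree_graph_single, of v ps] by (simp add: grown_def)

lemma steiner_tree_grown:
  assumes "simple_graph G" "v \<in> verts G" "growable {v} ps"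
    and "\<forall>(p, c) \<in> set ps. {p, c} \<in> edges G" "S \<subseteq> insert v (snd ` set ps)"
  shows "steiner_tree G S (grown v ps)"
proof -
  have "edges (grown v ps) \<subseteq> edges G"
    using assms(4) by (auto simp: grown_def)
  moreover have "verts (grown v ps) \<subseteq> verts G"
    using assms(1,2,4) by (fastforce simp: grown_def simple_graph_def)
  ultimately show ?thesis
    using tree_graph_grown[OF assms(3)] assms(5)
    by (auto simp: steiner_tree_def subgraph_def tree_graph_def grown_def)
qed

lemma steiner_tree_edge_at:
  assumes "steiner_tree G S T" "u \<in> S" "w \<in> S" "u \<noteq> w"
  obtains e where "e \<in> edges T" "u \<in> e"
proof -
  have "(u, w) \<in> {(x, y). {x, y} \<in> edges T}\<^sup>*"
    using assms by (auto simp: steiner_tree_def tree_graph_def connected_graph_def)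
  then show ?thesis
    using assms(4) that by (cases rule: converse_rtranclE) auto
qed

section \<open>Packings and additional stars\<close>

text \<open>The set \<open>X\<close> confines the edges of the packing, which leaves all edges that
  meet the outside of \<open>X\<close> free for further trees.\<close>

definition packs :: "'a ugraph \<Rightarrow> 'a set \<Rightarrow> 'a set \<Rightarrow> nat \<Rightarrow> bool" where
  "packs G S X k \<longleftrightarrow> (\<exists>\<T>. tree_packing G S \<T> \<and> card \<T> = k \<and> (\<forall>T\<in>\<T>. \<forall>e\<in>edges T. e \<subseteq> X))"

text \<open>A tree through two vertices has an edge, so it is not edge-disjoint from itself. Hence
  the list has no repetitions, and its length is the size of the packing.\<close>

lemma packs_list:
  assumes "\<forall>T\<in>set ts. steiner_tree G S T \<and> (\<forall>e\<in>edges T. e \<subseteq> X)"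
    and "sorted_wrt (\<lambda>T T'. edges T \<inter> edges T' = {}) ts"
    and "x \<in> S" "y \<in> S" "x \<noteq> y"
  shows "packs G S X (length ts)"
proof -
  let ?D = "\<lambda>T T'. edges T \<inter> edges T' = {}"
  have nonempty: "edges T \<noteq> {}" if "T \<in> set ts" for T
    using steiner_tree_edge_at[of G S T x y] that assms by auto
  have dj: "\<forall>T\<in>set us. \<forall>T'\<in>set us. T \<noteq> T' \<longrightarrow> ?D T T'" if "sorted_wrt ?D us" for us
    using that by (induction us) auto
  have "distinct us" if "sorted_wrt ?D us" "set us \<subseteq> set ts" for us
    using that nonempty by (induction us) auto
  then have "card (set ts) = length ts"
    using assms(2) distinct_card by blast
  moreover have "tree_packing G S (set ts)"
    using dj[OF assms(2)] assms(1) by (simp add: tree_packing_def)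
  ultimately show ?thesis
    unfolding packs_def using assms(1) by blast
qed

definition star :: "'a set \<Rightarrow> 'a \<Rightarrow> 'a ugraph" where
  "star S w = (insert w S, (\<lambda>s. {w, s}) ` S)"

text \<open>Every edge of a star centred outside \<open>X\<close> leaves \<open>X\<close>, so it
  meets no packed tree. Two such stars share no edge because neither centre lies in
  \<open>S\<close>.\<close>

lemma packs_add_stars:
  assumes G: "simple_graph G" and S: "finite S" "S \<noteq> {}" "S \<subseteq> X" "X \<subseteq> verts G"
    and P: "packs G S X k"
    and full: "\<And>w s. w \<in> verts G - X \<Longrightarrow> s \<in> S \<Longrightarrow> {w, s} \<in> edges G"
  shows "packs G S (verts G) (k + card (verts G - X))"
proof -
  obtain \<T> where T: "tree_packing G S \<T>" "card \<T> = k" and inX: "\<forall>T\<in>\<T>. \<forall>e\<in>edges T. e \<subseteq> X"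
    using P by (auto simp: packs_def)
  have fin: "finite (verts G)" using G by (simp add: simple_graph_def)
  let ?W = "verts G - X"
  let ?U = "star S ` ?W"
  obtain xs where xs: "set xs = S" "distinct xs" using S(1) finite_distinct_list by blast
  have st: "steiner_tree G S (star S w)" if w: "w \<in> ?W" for w
  proof -
    have ws: "w \<notin> S" using w S by auto
    have gr: "growable V (map (Pair w) ys)" if "w \<in> V" "distinct ys" "set ys \<inter> V = {}" for V ys
      using that by (induction ys arbitrary: V) auto
    have "star S w = grown w (map (Pair w) xs)"
      using xs by (auto simp: star_def grown_def image_iff)
    moreover have "steiner_tree G S (grown w (map (Pair w) xs))"
      using G w gr[of "{w}" xs] ws xs full[OF w] by (intro steiner_tree_grown) (auto simp: image_iff)
    ultimately show ?thesis by simp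
  qed
  have dj1: "edges (star S w) \<inter> edges (star S w') = {}" if "w \<in> ?W" "w' \<in> ?W" "w \<noteq> w'" for w w'
    using that S(3) by (auto simp: star_def doubleton_eq_iff)
  have dj2: "edges T \<inter> edges (star S w) = {}" if "T \<in> \<T>" "w \<in> ?W" for T w
    using inX that by (fastforce simp: star_def)
  have ne: "edges (star S w) \<noteq> {}" for w using S by (simp add: star_def)
  have inj: "inj_on (star S) ?W"
    using dj1 ne by (metis inf.idem inj_onI)
  have djs: "\<T> \<inter> ?U = {}" using dj2 ne by fastforce
  have finT: "finite \<T>"
    using T(1) finite_steiner_trees[OF G, of S] by (auto simp: tree_packing_def intro: rev_finite_subset)
  have "card (\<T> \<union> ?U) = k + card ?W"
    using card_Un_disjoint[OF finT _ djs] fin inj T(2) by (simp add: card_image)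
  moreover have "tree_packing G S (\<T> \<union> ?U)"
    unfolding tree_packing_def
  proof (intro conjI ballI impI)
    fix T assume "T \<in> \<T> \<union> ?U"
    then show "steiner_tree G S T" using T(1) st by (auto simp: tree_packing_def)
  next
    fix T T' assume TT: "T \<in> \<T> \<union> ?U" "T' \<in> \<T> \<union> ?U" "T \<noteq> T'"
    consider "T \<in> \<T>" "T' \<in> \<T>" | "T \<in> \<T>" "T' \<in> ?U" | "T \<in> ?U" "T' \<in> \<T>" | "T \<in> ?U" "T' \<in> ?U"
      using TT by blast
    then show "edges T \<inter> edges T' = {}"
    proof cases
      case 1
      then show ?thesis using T(1) TT(3) unfolding tree_packing_def by blast
    next
      case 2
      then show ?thesis using dj2 by blast
    next
      case 3
      then show ?thesis using dj2 by blast
    next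
      case 4
      then show ?thesis using dj1 TT(3) by blast
    qed
  qed
  moreover have "\<forall>T\<in>\<T> \<union> ?U. \<forall>e\<in>edges T. e \<subseteq> verts G"
  proof -
    have "\<forall>T\<in>\<T> \<union> ?U. steiner_tree G S T"
      using \<open>tree_packing G S (\<T> \<union> ?U)\<close> by (simp add: tree_packing_def)
    then show ?thesis
      unfolding steiner_tree_def subgraph_def simple_graph_def by blast
  qed
  ultimately show ?thesis unfolding packs_def by blast
qed

lemma packs_le_local_lambda:
  assumes "simple_graph G" "packs G S X k"
  shows "k \<le> local_lambda G S"
  using assms local_lambda_well_defined[OF assms(1), of S]
  unfolding packs_def local_lambda_def by (auto intro!: Max_ge)

lemma local_lambda_packing:
  assumes "simple_graph G"
  obtains \<T> where "tree_packing G S \<T>" "card \<T> = local_lambda G S"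
  using Max_in[OF local_lambda_well_defined[OF assms, of S]]
  unfolding local_lambda_def by auto

section \<open>Degree bounds on packings\<close>

text \<open>Each tree has an edge at \<open>u\<close>, and edge-disjointness makes any choice of
  such edges injective.\<close>

lemma tree_packing_edge_map:
  assumes "tree_packing G S \<T>" "u \<in> S" "w \<in> S" "u \<noteq> w"
  obtains f where "inj_on f \<T>" "\<And>T. T \<in> \<T> \<Longrightarrow> f T \<in> edges T"
    "f ` \<T> \<subseteq> {e \<in> edges G. u \<in> e}"
proof -
  have "\<forall>T\<in>\<T>. \<exists>e. e \<in> edges T \<and> u \<in> e"
    using assms steiner_tree_edge_at[of G S _ u w] unfolding tree_packing_def by metis
  then obtain f where f: "\<And>T. T \<in> \<T> \<Longrightarrow> f T \<in> edges T \<and> u \<in> f T" by metis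
  have "inj_on f \<T>"
    using f assms(1) unfolding tree_packing_def by (metis IntI empty_iff inj_onI)
  moreover have "f ` \<T> \<subseteq> {e \<in> edges G. u \<in> e}"
    using f assms(1) unfolding tree_packing_def steiner_tree_def subgraph_def by blast
  ultimately show ?thesis using f that by blast
qed

lemma finite_edges: "simple_graph G \<Longrightarrow> finite (edges G)"
  by (rule finite_subset[of _ "Pow (verts G)"]) (auto simp: simple_graph_def)

lemma tree_packing_card_le_degree:
  assumes "simple_graph G" "tree_packing G S \<T>" "u \<in> S" "w \<in> S" "u \<noteq> w"
  shows "card \<T> \<le> card {e \<in> edges G. u \<in> e}"
proof -
  obtain f where "inj_on f \<T>" "f ` \<T> \<subseteq> {e \<in> edges G. u \<in> e}"
    using tree_packing_edge_map[OF assms(2-)] by metis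
  then show ?thesis using finite_edges[OF assms(1)] by (auto intro: card_inj_on_le)
qed

text \<open>With as many trees as edges at \<open>u\<close>, the injection from trees to these edges
  is onto. So all of them are used, and \<open>u\<close> is a leaf of every tree.\<close>

lemma tight_packing_unique_edge:
  assumes "simple_graph G" "tree_packing G S \<T>" "u \<in> S" "w \<in> S" "u \<noteq> w"
    and "card {e \<in> edges G. u \<in> e} \<le> card \<T>"
  shows "\<And>e. e \<in> edges G \<Longrightarrow> u \<in> e \<Longrightarrow> \<exists>T\<in>\<T>. e \<in> edges T"
    and "\<And>T e e'. T \<in> \<T> \<Longrightarrow> e \<in> edges T \<Longrightarrow> e' \<in> edges T \<Longrightarrow> u \<in> e \<Longrightarrow> u \<in> e' \<Longrightarrow> e = e'"
proof -
  obtain f where f: "inj_on f \<T>" "\<And>T. T \<in> \<T> \<Longrightarrow> f T \<in> edges T"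
    "f ` \<T> \<subseteq> {e \<in> edges G. u \<in> e}"
    using tree_packing_edge_map[OF assms(2-5)] by metis
  have eq: "f ` \<T> = {e \<in> edges G. u \<in> e}"
    using f(1,3) assms(6) finite_edges[OF assms(1)]
    by (intro card_seteq) (auto simp: card_image)
  then show ex: "\<exists>T\<in>\<T>. e \<in> edges T" if "e \<in> edges G" "u \<in> e" for e
  proof -
    have "e \<in> f ` \<T>" using eq that by simp
    then show ?thesis using f(2) by auto
  qed
  have "e = f T" if "T \<in> \<T>" "e \<in> edges T" "u \<in> e" for T e
  proof -
    have "e \<in> edges G"
      using that assms(2) unfolding tree_packing_def steiner_tree_def subgraph_def by blast
    then obtain T' where "T' \<in> \<T>" "e = f T'" using eq \<open>u \<in> e\<close> by blast
    then have "e \<in> edges T \<inter> edges T'" using that f(2) by auto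
    then have "T = T'"
      using that(1) \<open>T' \<in> \<T>\<close> assms(2) unfolding tree_packing_def by (metis empty_iff)
    then show ?thesis using \<open>e = f T'\<close> by simp
  qed
  then show "\<And>T e e'. T \<in> \<T> \<Longrightarrow> e \<in> edges T \<Longrightarrow> e' \<in> edges T \<Longrightarrow> u \<in> e \<Longrightarrow> u \<in> e' \<Longrightarrow> e = e'"
    by metis
qed

lemma tree_packing_card_less:
  assumes G: "simple_graph G" and P: "tree_packing G S \<T>"
    and S: "u \<in> S" "v \<in> S" "w \<in> S" "u \<noteq> v" "u \<noteq> w" "v \<noteq> w"
    and uv: "{u, v} \<in> edges G"
    and deg: "card {e \<in> edges G. u \<in> e} \<le> d" "card {e \<in> edges G. v \<in> e} \<le> d"
  shows "card \<T> < d"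
proof (rule ccontr)
  assume "\<not> card \<T> < d"
  then have du: "card {e \<in> edges G. u \<in> e} \<le> card \<T>" and dv: "card {e \<in> edges G. v \<in> e} \<le> card \<T>"
    using deg by auto
  note U = tight_packing_unique_edge[OF G P S(1,3,5) du]
  note V = tight_packing_unique_edge[OF G P S(2,3,6) dv]
  obtain T where T: "T \<in> \<T>" "{u, v} \<in> edges T" using U(1)[OF uv] by auto
  have "(u, w) \<in> {(x, y). {x, y} \<in> edges T}\<^sup>*"
    using P T S unfolding tree_packing_def steiner_tree_def tree_graph_def connected_graph_def by blast
  \<comment> \<open>A walk in \<open>T\<close> from \<open>u\<close> cannot leave
    \<open>{u, v}\<close>: this edge is the only one of \<open>T\<close> at \<open>u\<close> and the
    only one at \<open>v\<close>.\<close>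
  then have "w \<in> {u, v}"
  proof (induction rule: rtrancl_induct)
    case (step y z)
    then have "{y, z} = {u, v}"
      using U(2)[OF T(1) T(2), of "{y, z}"] V(2)[OF T(1) T(2), of "{y, z}"] by auto
    then show ?case by auto
  qed simp
  then show False using S by auto
qed

section \<open>Packings when the complement is thin\<close>

text \<open>A packing given as data, each entry being a root with its list of attachments. All
  conditions are bounded quantifiers over lists, which simplification unfolds for concrete
  entries.\<close>

lemma packs_grown:
  assumes G: "simple_graph G" and X: "X \<subseteq> verts G" and S: "x \<in> S" "y \<in> S" "x \<noteq> y"
    and tps: "\<forall>(v, ps) \<in> set tps. v \<in> X \<and> growable {v} ps \<and> S \<subseteq> insert v (snd ` set ps) \<and>
      (\<forall>(p, c) \<in> set ps. {p, c} \<in> edges G \<and> p \<in> X \<and> c \<in> X)"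
    and dj: "sorted_wrt (\<lambda>(v, ps) (w, qs). \<forall>(p, c) \<in> set ps. \<forall>(p', c') \<in> set qs. {p, c} \<noteq> {p', c'}) tps"
  shows "packs G S X (length tps)"
proof -
  let ?f = "\<lambda>(v, ps). grown v ps"
  have "packs G S X (length (map ?f tps))"
  proof (rule packs_list[OF _ _ S])
    show "\<forall>T\<in>set (map ?f tps). steiner_tree G S T \<and> (\<forall>e\<in>edges T. e \<subseteq> X)"
    proof
      fix T assume "T \<in> set (map ?f tps)"
      then obtain v ps where vp: "(v, ps) \<in> set tps" "T = grown v ps" by auto
      then have "v \<in> X \<and> growable {v} ps \<and> S \<subseteq> insert v (snd ` set ps) \<and>
        (\<forall>(p, c) \<in> set ps. {p, c} \<in> edges G \<and> p \<in> X \<and> c \<in> X)"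
        using tps by blast
      then show "steiner_tree G S T \<and> (\<forall>e\<in>edges T. e \<subseteq> X)"
        using vp(2) steiner_tree_grown[OF G, of v ps S] X by (fastforce simp: grown_def)
    qed
    have "sorted_wrt (\<lambda>p q. edges (?f p) \<inter> edges (?f q) = {}) tps"
      by (rule sorted_wrt_mono_rel[OF _ dj]) (fastforce simp: grown_def)
    then show "sorted_wrt (\<lambda>T T'. edges T \<inter> edges T' = {}) (map ?f tps)"
      by (simp add: sorted_wrt_map)
  qed
  then show ?thesis by simp
qed

section \<open>Thin complements\<close>

text \<open>The degree conditions are expressed by naming neighbours instead of counting them, which
  suits arguments about a few explicit vertices.\<close>

definition thin_graph :: "'a ugraph \<Rightarrow> bool" where
  "thin_graph H \<longleftrightarrow>
     (\<forall>v x y z. {v, x} \<in> edges H \<longrightarrow> {v, y} \<in> edges H \<longrightarrow> {v, z} \<in> edges H \<longrightarrow> x = y \<or> x = z \<or> y = z) \<and>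
     (\<forall>u v x y x' y'. {u, x} \<in> edges H \<longrightarrow> {u, y} \<in> edges H \<longrightarrow> x \<noteq> y \<longrightarrow>
        {v, x'} \<in> edges H \<longrightarrow> {v, y'} \<in> edges H \<longrightarrow> x' \<noteq> y' \<longrightarrow> u \<noteq> v \<longrightarrow> {u, v} \<in> edges H)"

lemma thin_graphI:
  assumes "\<And>v x y z. {v, x} \<in> edges H \<Longrightarrow> {v, y} \<in> edges H \<Longrightarrow> {v, z} \<in> edges H \<Longrightarrow> x = y \<or> x = z \<or> y = z"
    and "\<And>u v x y x' y'. {u, x} \<in> edges H \<Longrightarrow> {u, y} \<in> edges H \<Longrightarrow> x \<noteq> y \<Longrightarrow>
        {v, x'} \<in> edges H \<Longrightarrow> {v, y'} \<in> edges H \<Longrightarrow> x' \<noteq> y' \<Longrightarrow> u \<noteq> v \<Longrightarrow> {u, v} \<in> edges H"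
  shows "thin_graph H"
  unfolding thin_graph_def
proof (intro conjI allI impI)
  fix v x y z
  show "x = y \<or> x = z \<or> y = z" if "{v, x} \<in> edges H" "{v, y} \<in> edges H" "{v, z} \<in> edges H"
    using that by (rule assms(1))
next
  fix u v x y x' y'
  show "{u, v} \<in> edges H" if "{u, x} \<in> edges H" "{u, y} \<in> edges H" "x \<noteq> y"
    "{v, x'} \<in> edges H" "{v, y'} \<in> edges H" "x' \<noteq> y'" "u \<noteq> v"
    using that by (rule assms(2))
qed

lemma thin_graphD:
  assumes "thin_graph H"
  shows "\<And>v x y z. {v, x} \<in> edges H \<Longrightarrow> {v, y} \<in> edges H \<Longrightarrow> {v, z} \<in> edges H \<Longrightarrow> x = y \<or> x = z \<or> y = z"
    and "\<And>u v x y x' y'. {u, x} \<in> edges H \<Longrightarrow> {u, y} \<in> edges H \<Longrightarrow> x \<noteq> y \<Longrightarrow>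
        {v, x'} \<in> edges H \<Longrightarrow> {v, y'} \<in> edges H \<Longrightarrow> x' \<noteq> y' \<Longrightarrow> u \<noteq> v \<Longrightarrow> {u, v} \<in> edges H"
  subgoal by (rule assms[unfolded thin_graph_def, THEN conjunct1, rule_format])
  subgoal by (rule assms[unfolded thin_graph_def, THEN conjunct2, rule_format])
  done

text \<open>\<open>N\<close> is adjacency in the complement, so \<open>N x y\<close> says that the
  distinct vertices \<open>x\<close> and \<open>y\<close> miss each other in \<open>G\<close>;
  \<open>nb x\<close> is the set of these nonneighbours.\<close>

locale thin_complement =
  fixes G :: "'a ugraph" and N :: "'a \<Rightarrow> 'a \<Rightarrow> bool" and nb :: "'a \<Rightarrow> 'a set"
  assumes G: "simple_graph G" and thin: "thin_graph (complement G)"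
    and N: "\<And>x y. N x y \<longleftrightarrow> {x, y} \<in> edges (complement G)"
    and nb: "\<And>x. nb x = {y. N x y}"
begin

lemma N_sym: "N x y \<Longrightarrow> N y x"
  by (simp add: N insert_commute)

lemma N_irrefl: "\<not> N x x"
  by (auto simp: N complement_def)

lemma N_verts: "N x y \<Longrightarrow> x \<in> verts G \<and> y \<in> verts G"
  by (auto simp: N complement_def)

lemma edge: "x \<in> verts G \<Longrightarrow> y \<in> verts G \<Longrightarrow> x \<noteq> y \<Longrightarrow> \<not> N x y \<Longrightarrow> {x, y} \<in> edges G"
  by (auto simp: N complement_def)

lemma deg_le_2: "N v x \<Longrightarrow> N v y \<Longrightarrow> N v z \<Longrightarrow> x = y \<or> x = z \<or> y = z"
  unfolding N by (rule thin_graphD(1)[OF thin])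

lemma deg_2_adjacent:
  "N u x \<Longrightarrow> N u y \<Longrightarrow> x \<noteq> y \<Longrightarrow> N v x' \<Longrightarrow> N v y' \<Longrightarrow> x' \<noteq> y' \<Longrightarrow> u \<noteq> v \<Longrightarrow> N u v"
  unfolding N by (rule thin_graphD(2)[OF thin])

lemma nbD: "nb x = A \<Longrightarrow> N x y \<longleftrightarrow> y \<in> A" "nb x = A \<Longrightarrow> N y x \<longleftrightarrow> y \<in> A"
  using N_sym by (auto simp: nb)

lemma nb_cases:
  obtains "nb x = {}" | d where "nb x = {d}" | d e where "nb x = {d, e}" "d \<noteq> e"
proof -
  consider "nb x = {}" | d where "nb x = {d}" | d e where "d \<in> nb x" "e \<in> nb x" "d \<noteq> e"
    by blast
  then show thesis
  proof cases
    case 3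
    then have "nb x = {d, e}" using deg_le_2[of x d e] by (auto simp: nb)
    then show ?thesis using 3 that by blast
  qed (use that in auto)
qed

lemma nb_one_of:
  assumes "N x y"
  shows "nb x = {y} \<or> (\<exists>z. nb x = {y, z} \<and> N x z \<and> z \<noteq> x \<and> z \<noteq> y \<and> z \<in> verts G)"
proof (cases "nb x = {y}")
  case False
  then obtain z where z: "N x z" "z \<noteq> y" using assms by (auto simp: nb)
  then have "nb x = {y, z}" using deg_le_2[OF assms z(1)] assms by (auto simp: nb)
  then show ?thesis using z N_irrefl N_verts by blast
qed simp

text \<open>The list \<open>bs\<close> has to contain every outer vertex that misses an edge to \<open>{a, b, c}\<close>; each of the
  remaining vertices is the centre of a star.\<close>

lemma packs_build_plus:
  assumes "distinct (a # b # c # bs)" "set (a # b # c # bs) \<subseteq> verts G"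
    and nbs: "nb a \<union> nb b \<union> nb c \<subseteq> set (a # b # c # bs)"
    and len: "length tps = length bs + m"
    and "\<forall>(v, ps) \<in> set tps. v \<in> set (a # b # c # bs) \<and> growable {v} ps \<and>
      {a, b, c} \<subseteq> insert v (snd ` set ps) \<and>
      (\<forall>(p, c') \<in> set ps. {p, c'} \<in> edges G \<and> p \<in> set (a # b # c # bs) \<and> c' \<in> set (a # b # c # bs))"
    and "sorted_wrt (\<lambda>(v, ps) (w, qs). \<forall>(p, c) \<in> set ps. \<forall>(p', c') \<in> set qs. {p, c} \<noteq> {p', c'}) tps"
  shows "packs G {a, b, c} (verts G) (card (verts G) - 3 + m)"
proof -
  let ?X = "set (a # b # c # bs)"
  have "packs G {a, b, c} ?X (length tps)"
    using assms by (intro packs_grown[OF G, where x = a and y = b]) auto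
  moreover have "{w, s} \<in> edges G" if "w \<in> verts G - ?X" "s \<in> {a, b, c}" for w s
  proof (rule edge)
    show "\<not> N w s" using that nbs N_sym by (fastforce simp: nb)
  qed (use that assms(2) in auto)
  ultimately have "packs G {a, b, c} (verts G) (length tps + card (verts G - ?X))"
    using assms(2) by (intro packs_add_stars[OF G]) auto
  moreover have "card (verts G - ?X) = card (verts G) - (3 + length bs)"
    using assms(1,2) G card_Diff_subset[of ?X "verts G"] distinct_card[OF assms(1)]
    by (simp add: simple_graph_def)
  \<comment> \<open>This bound keeps the natural subtractions from being truncated when trees and
    stars are added up.\<close>
  moreover have "3 + length bs \<le> card (verts G)"
    using card_mono[OF _ assms(2)] distinct_card[OF assms(1)] G by (simp add: simple_graph_def)
  ultimately show ?thesis using len by (simp add: add.commute)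
qed

lemma packs_build:
  assumes "distinct (a # b # c # bs)" "set (a # b # c # bs) \<subseteq> verts G"
    and "nb a \<union> nb b \<union> nb c \<subseteq> set (a # b # c # bs)"
    and "length tps = length bs"
    and "\<forall>(v, ps) \<in> set tps. v \<in> set (a # b # c # bs) \<and> growable {v} ps \<and>
      {a, b, c} \<subseteq> insert v (snd ` set ps) \<and>
      (\<forall>(p, c') \<in> set ps. {p, c'} \<in> edges G \<and> p \<in> set (a # b # c # bs) \<and> c' \<in> set (a # b # c # bs))"
    and "sorted_wrt (\<lambda>(v, ps) (w, qs). \<forall>(p, c) \<in> set ps. \<forall>(p', c') \<in> set qs. {p, c} \<noteq> {p', c'}) tps"
  shows "packs G {a, b, c} (verts G) (card (verts G) - 3)"
  using packs_build_plus[of a b c bs tps 0] assms by simp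

section \<open>Triples that contain a nonedge\<close>

text \<open>Besides each other, \<open>a\<close> and \<open>b\<close> have at most one nonneighbour
  each. The cases follow the nonneighbours of \<open>c\<close>: if \<open>c\<close> has two, then
  \<open>a\<close> and \<open>b\<close> have no further one, since vertices with two nonneighbours
  miss each other.\<close>

lemma packs_one_nonedge:
  assumes V: "a \<in> verts G" "b \<in> verts G" "c \<in> verts G" and d: "a \<noteq> b" "a \<noteq> c" "b \<noteq> c"
    and ab: "N a b" "\<not> N a c" "\<not> N b c"
  shows "packs G {a, b, c} (verts G) (card (verts G) - 3)"
proof -
  have ba: "N b a" "\<not> N c a" "\<not> N c b" using ab N_sym by blast+
  \<comment> \<open>The inner path \<open>a\<close>, \<open>c\<close>, \<open>b\<close> takes the
    place of the star at the single defective vertex \<open>d\<close>. If \<open>d\<close> lies in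
    the triple, every outer vertex has its star.\<close>
  have one: ?thesis if "nb a \<union> nb b \<union> nb c \<subseteq> {a, b, c, d}" "d \<in> verts G" for d
  proof (cases "d \<in> {a, b, c}")
    case True
    then show ?thesis
      using V \<open>a \<noteq> b\<close> assms(5,6) that by (intro packs_build[where bs = "[]" and tps = "[]"]) auto
  next
    case False
    then show ?thesis
      using V \<open>a \<noteq> b\<close> assms(5,6) that ab ba
      by (intro packs_build[where bs = "[d]" and tps = "[(a, [(a, c), (c, b)])]"]) (auto intro: edge)
  qed
  have A: "nb a = {b} \<or> (\<exists>p. nb a = {b, p} \<and> p \<notin> {a, b, c} \<and> p \<in> verts G)"
    using nb_one_of[OF ab(1)] ab(2) by (auto simp: nb)
  have B: "nb b = {a} \<or> (\<exists>p. nb b = {a, p} \<and> p \<notin> {a, b, c} \<and> p \<in> verts G)"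
    using nb_one_of[OF ba(1)] ab(3) by (auto simp: nb)
  have c_out: "q \<notin> {a, b, c}" "q \<in> verts G" if "q \<in> nb c" for q
    using that ba N_irrefl N_verts by (auto simp: nb)
  \<comment> \<open>Of the triple, \<open>d\<close> misses only \<open>b\<close> and
    \<open>f\<close> misses only \<open>c\<close>. The inner edge \<open>{b, c}\<close> attaches
    \<open>b\<close> to the tree through \<open>d\<close>, and \<open>{a, c}\<close> attaches
    \<open>c\<close> to the tree through \<open>f\<close>.\<close>
  have two: ?thesis if nbs: "nb a = {b}" "nb b = {a, d}" "d \<notin> {a, b, c}" "d \<in> verts G"
    "nb c = {f}" "f \<noteq> d" for d f
    using V assms(4-6) nbs c_out[of f]
    by (intro packs_build[where bs = "[d, f]" and
          tps = "[(b, [(b, f), (f, a), (a, c)]), (b, [(b, c), (c, d), (d, a)])]"])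
       (auto intro!: edge simp: nbD[OF nbs(1)] nbD[OF nbs(2)] nbD[OF nbs(5)] doubleton_eq_iff)
  have two': ?thesis if nbs: "nb b = {a}" "nb a = {b, d}" "d \<notin> {a, b, c}" "d \<in> verts G"
    "nb c = {f}" "f \<noteq> d" for d f
    using V assms(4-6) nbs c_out[of f]
    by (intro packs_build[where bs = "[d, f]" and
          tps = "[(a, [(a, f), (f, b), (b, c)]), (a, [(a, c), (c, d), (d, b)])]"])
       (auto intro!: edge simp: nbD[OF nbs(1)] nbD[OF nbs(2)] nbD[OF nbs(5)] doubleton_eq_iff)
  show ?thesis
  proof (cases rule: nb_cases[of c])
    case 1
    show ?thesis
    proof (cases "nb a = {b} \<or> nb b = {a}")
      case True
      then show ?thesis
        using A B 1 V one[of a] one by auto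
    next
      case False
      then obtain d' d where nbs: "nb a = {b, d'}" "d' \<notin> {a, b, c}" "d' \<in> verts G"
        "nb b = {a, d}" "d \<notin> {a, b, c}" "d \<in> verts G" using A B by blast
      show ?thesis
      proof (cases "d = d'")
        case True
        then show ?thesis using nbs 1 one[of d] by auto
      next
        case False
        then show ?thesis
          using V assms(4-6) nbs 1
          by (intro packs_build[where bs = "[d, d']" and
                tps = "[(a, [(a, c), (c, d'), (d', b)]), (b, [(b, c), (c, d), (d, a)])]"])
             (auto intro!: edge simp: nbD[OF nbs(1)] nbD[OF nbs(4)] nbD[OF 1] doubleton_eq_iff)
      qed
    qed
  next
    case (2 f)
    then have f: "f \<notin> {a, b, c}" "f \<in> verts G" using c_out by auto
    have Nf: "N f c" by (simp add: nbD[OF 2])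
    show ?thesis
    proof (cases "nb a = {b}")
      case nba: True
      show ?thesis
      proof (cases "nb b = {a}")
        case True
        then show ?thesis using nba 2 f one[of f] by auto
      next
        case False
        then obtain d where "nb b = {a, d}" "d \<notin> {a, b, c}" "d \<in> verts G" using B by blast
        then show ?thesis using nba 2 f one[of f] two[of d f] by (cases "f = d") auto
      qed
    next
      case nba: False
      then obtain d' where d': "nb a = {b, d'}" "d' \<notin> {a, b, c}" "d' \<in> verts G" using A by blast
      show ?thesis
      proof (cases "nb b = {a}")
        case True
        then show ?thesis using d' 2 f one[of f] two'[of d' f] by (cases "f = d'") auto
      next
        case False
        then obtain d where d: "nb b = {a, d}" "d \<notin> {a, b, c}" "d \<in> verts G" using B by blast
        have Nd: "N d b" "N d' a" "N b d" "N a d'" by (simp_all add: nbD[OF d(1)] nbD[OF d'(1)])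
        have ne: "b \<noteq> d'" "a \<noteq> d" "a \<noteq> d'" "b \<noteq> d" "f \<noteq> a" "f \<noteq> b" "c \<noteq> a" "c \<noteq> b"
          using d d' f assms(5,6) by auto
        \<comment> \<open>If \<open>f = d\<close>, then \<open>d\<close> misses \<open>b\<close> and
          \<open>c\<close>. Since \<open>a\<close> has two nonneighbours as well, \<open>d\<close>
          would also miss \<open>a\<close>, its third nonneighbour.\<close>
        have fd: "f \<noteq> d"
        proof
          assume "f = d"
          then have dc: "N d c" using Nf by simp
          have "N a d" by (rule deg_2_adjacent[OF ab(1) Nd(4) ne(1) Nd(1) dc assms(6) ne(2)])
          then show False using deg_le_2[OF N_sym Nd(1) dc, of a] assms(4-6) by blast
        qed
        have fd': "f \<noteq> d'"
        proof
          assume "f = d'"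
          then have dc: "N d' c" using Nf by simp
          have "N b d'" by (rule deg_2_adjacent[OF ba(1) Nd(3) ne(2) Nd(2) dc assms(5) ne(1)])
          then show False using deg_le_2[OF N_sym Nd(2) dc, of b] assms(4-6) by blast
        qed
        show ?thesis
        proof (cases "d = d'")
          case True
          \<comment> \<open>Already missing \<open>a\<close> and \<open>b\<close>, the vertex
            \<open>d\<close> is adjacent to \<open>f\<close>. So the star at \<open>f\<close>
            reaches \<open>c\<close> through \<open>d\<close>, and the two inner edges form the
            other tree.\<close>
          have "\<not> N d f" using deg_le_2[OF Nd(1), of a f] Nd(2) True ne assms(4) by metis
          then have "\<not> N f d" "\<not> N d f" using N_sym by blast+
          then show ?thesis
            using V assms(4-6) d d' True f fd 2
            by (intro packs_build[where bs = "[d, f]" and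
                  tps = "[(a, [(a, c), (c, b)]), (f, [(f, a), (f, b), (f, d), (d, c)])]"])
               (auto intro!: edge simp: nbD[OF d'(1)] nbD[OF d(1)] nbD[OF 2] doubleton_eq_iff)
        next
          case False
          \<comment> \<open>Three outer vertices miss one member each, but there are only two inner
            edges. These form one tree, and \<open>f\<close> is the bridge that leads
            \<open>d\<close> to \<open>b\<close> and \<open>d'\<close> to \<open>a\<close>. The
            bridge exists: if \<open>d\<close> missed \<open>f\<close> besides \<open>b\<close>, it
            would also miss \<open>a\<close>, whose nonneighbours are \<open>b\<close> and
            \<open>d'\<close>; likewise for \<open>d'\<close> and \<open>b\<close>.\<close>
          have "\<not> N d f"
            using deg_2_adjacent[OF ab(1) Nd(4) ne(1) Nd(1) _ ne(6)[symmetric] ne(2)] False ne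
            by (auto simp: nbD[OF d'(1)])
          moreover have "\<not> N d' f"
            using deg_2_adjacent[OF ba(1) Nd(3) ne(2) Nd(2) _ ne(5)[symmetric] ne(1)] False ne
            by (auto simp: nbD[OF d(1)])
          ultimately have "\<not> N d f" "\<not> N d' f" "\<not> N f d" "\<not> N f d'" using N_sym by blast+
          then show ?thesis
            using V assms(4-6) d d' False f fd fd' 2
            by (intro packs_build[where bs = "[d, d', f]" and
                  tps = "[(a, [(a, c), (c, b)]), (a, [(a, d), (d, c), (d, f), (f, b)]),
                    (a, [(a, f), (f, d'), (d', b), (d', c)])]"])
               (auto intro!: edge simp: nbD[OF d'(1)] nbD[OF d(1)] nbD[OF 2] doubleton_eq_iff)
        qed
      qed
    qed
  next
    case (3 d e)
    have Nc: "N c d" "N c e" by (simp_all add: nbD[OF 3(1)])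
    have nba: "nb a = {b}"
    proof (rule ccontr)
      assume "nb a \<noteq> {b}"
      then obtain p where p: "nb a = {b, p}" "p \<notin> {a, b, c}" using A by blast
      then show False
        using deg_2_adjacent[OF ab(1) _ _ Nc 3(2) assms(5), of p] ab(2) by (auto simp: nbD[OF p(1)])
    qed
    have nbb: "nb b = {a}"
    proof (rule ccontr)
      assume "nb b \<noteq> {a}"
      then obtain p where p: "nb b = {a, p}" "p \<notin> {a, b, c}" using B by blast
      then show False
        using deg_2_adjacent[OF ba(1) _ _ Nc 3(2) assms(6), of p] ab(3) by (auto simp: nbD[OF p(1)])
    qed
    show ?thesis
      using V assms(4-6) 3 c_out[of d] c_out[of e]
      by (intro packs_build[where bs = "[d, e]" and
            tps = "[(c, [(c, a), (a, d), (d, b)]), (c, [(c, b), (b, e), (e, a)])]"])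
         (auto intro!: edge simp: nba nbb nbD[OF nba] nbD[OF nbb] nbD[OF 3(1)] doubleton_eq_iff)
  qed
qed

text \<open>Both nonneighbours of \<open>b\<close> lie in the triple. If \<open>a\<close> and
  \<open>c\<close> both have a second nonneighbour, they miss each other, and no outer vertex is
  defective. Otherwise at most one is, and the inner edge \<open>{a, c}\<close> repairs its
  tree.\<close>

lemma packs_path_nonedges:
  assumes V: "a \<in> verts G" "b \<in> verts G" "c \<in> verts G" and d: "a \<noteq> b" "a \<noteq> c" "b \<noteq> c"
    and ab: "N a b" "N b c"
  shows "packs G {a, b, c} (verts G) (card (verts G) - 3)"
proof -
  have ba: "N b a" "N c b" using ab N_sym by blast+
  have nbb: "nb b = {a, c}" using deg_le_2[OF ab(2) ba(1)] ab ba d(2) by (auto simp: nb)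
  have zero: ?thesis if "nb a \<subseteq> {b, c}" "nb c \<subseteq> {a, b}"
    using V d that nbb by (intro packs_build[where bs = "[]" and tps = "[]"]) auto
  have one: ?thesis if nbs: "nb x = {b}" "nb y = {b, p}" "p \<noteq> y" "p \<noteq> b" "p \<in> verts G"
    "{x, y} = {a, c}" for x y p
  proof -
    have ne: "x \<noteq> b" "y \<noteq> b" "x \<noteq> y" "x \<in> verts G" "y \<in> verts G"
      using nbs(6) V d by (auto simp: doubleton_eq_iff)
    have px: "p \<noteq> x" using nbs(1,2) nbD[OF nbs(2), of p] nbD[OF nbs(1), of y] ne by auto
    have nbb': "nb b = {x, y}" using nbb nbs(6) by simp
    have "packs G {x, b, y} (verts G) (card (verts G) - 3)"
      using V(2) nbs(1-5) px ne
      by (intro packs_build[where bs = "[p]" and tps = "[(y, [(y, x), (x, p), (p, b)])]"])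
         (simp_all add: edge nbb' nbD[OF nbs(1)] nbD[OF nbs(2)] nbD[OF nbb'])
    moreover have "{x, b, y} = {a, b, c}" using nbs(6) by auto
    ultimately show ?thesis by simp
  qed
  consider "nb a = {b}" "nb c = {b}"
    | p where "nb a = {b}" "nb c = {b, p}" "p \<noteq> c" "p \<noteq> b" "p \<in> verts G"
    | p where "nb c = {b}" "nb a = {b, p}" "p \<noteq> a" "p \<noteq> b" "p \<in> verts G"
    | p q where "nb a = {b, p}" "nb c = {b, q}" "N a p" "N c q" "p \<noteq> b" "q \<noteq> b"
    using nb_one_of[OF ab(1)] nb_one_of[OF ba(2)] by metis
  then show ?thesis
  proof cases
    case 1
    then show ?thesis using zero by auto
  next
    case 2
    then show ?thesis using one[of a c] by auto
  next
    case 3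
    then show ?thesis using one[of c a] by auto
  next
    case 4
    have ac: "N a c"
      by (rule deg_2_adjacent[OF ab(1) 4(3) 4(5)[symmetric] ba(2) 4(4) 4(6)[symmetric] d(2)])
    then have "N c a" by (rule N_sym)
    then have "p = c" "q = a" using ac 4(1,2) d by (auto simp: nb)
    then show ?thesis using zero 4(1,2) by auto
  qed
qed

section \<open>Triples of pairwise adjacent vertices\<close>

text \<open>The inner path \<open>a\<close>, \<open>c\<close>, \<open>b\<close> takes the place of a
  star at \<open>q\<close>; the third inner edge \<open>{a, b}\<close> attaches \<open>a\<close> to
  the path \<open>b\<close>, \<open>p\<close>, \<open>c\<close>.\<close>

lemma packs_independent_two_outer:
  assumes V: "a \<in> verts G" "b \<in> verts G" "c \<in> verts G" "p \<in> verts G" "q \<in> verts G"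
    and d: "a \<noteq> b" "a \<noteq> c" "b \<noteq> c" "p \<noteq> q" "p \<notin> {a, b, c}" "q \<notin> {a, b, c}"
    and indep: "\<not> N a b" "\<not> N a c" "\<not> N b c"
    and nbs: "nb a \<union> nb b \<union> nb c \<subseteq> {p, q}"
    and p: "\<not> N b p" "\<not> N c p"
  shows "packs G {a, b, c} (verts G) (card (verts G) - 3)"
proof -
  have "\<not> N p b" "\<not> N p c" "\<not> N b a" "\<not> N c a" "\<not> N c b" using p indep N_sym by blast+
  then show ?thesis
    using assms
    by (intro packs_build[where bs = "[p, q]" and
          tps = "[(a, [(a, c), (c, b)]), (a, [(a, b), (b, p), (p, c)])]"])
       (auto intro!: edge simp: doubleton_eq_iff)
qed

text \<open>Two vertices with two nonneighbours each would miss each other, so a pairwise adjacent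
  triple has at most one such vertex; its role is given to \<open>a\<close>. The cases then go by
  the number of defective outer vertices, which is at most four.\<close>

lemma packs_independent_aux:
  assumes V: "a \<in> verts G" "b \<in> verts G" "c \<in> verts G" and d: "a \<noteq> b" "a \<noteq> c" "b \<noteq> c"
    and indep: "\<not> N a b" "\<not> N a c" "\<not> N b c"
    and nbb: "nb b = {} \<or> nb b = {f}" and nbc: "nb c = {} \<or> nb c = {g}"
  shows "packs G {a, b, c} (verts G) (card (verts G) - 3)"
proof -
  have indep': "\<not> N b a" "\<not> N c a" "\<not> N c b" using indep N_sym by blast+
  have out: "x \<notin> {a, b, c} \<and> x \<in> verts G" if "x \<in> nb a \<union> nb b \<union> nb c" for x
    using that indep indep' N_irrefl N_verts by (auto simp: nb)
  have one: ?thesis if B: "nb a \<union> nb b \<union> nb c \<subseteq> {p}" for p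
  proof (cases "p \<in> nb a \<union> nb b \<union> nb c")
    case True
    then show ?thesis
      using out[OF True] B V d indep indep'
      by (intro packs_build[where bs = "[p]" and tps = "[(a, [(a, c), (c, b)])]"])
         (auto intro!: edge)
  next
    case False
    then have "nb a \<union> nb b \<union> nb c = {}" using B by blast
    then show ?thesis
      using V d by (intro packs_build[where bs = "[]" and tps = "[]"]) auto
  qed
  have two: ?thesis if B: "nb a \<union> nb b \<union> nb c = {p, q}" and "p \<noteq> q" for p q
  proof -
    have pq: "p \<notin> {a, b, c}" "p \<in> verts G" "q \<notin> {a, b, c}" "q \<in> verts G"
      using out[of p] out[of q] B by auto
    have fin: ?thesis if B: "nb a \<union> nb b \<union> nb c \<subseteq> {r, s}" and r: "r \<noteq> s"
      "r \<notin> {a, b, c}" "r \<in> verts G" "s \<notin> {a, b, c}" "s \<in> verts G"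
      and n: "\<not> N b r \<and> \<not> N c r \<or> \<not> N a r \<and> \<not> N c r \<or> \<not> N a r \<and> \<not> N b r" for r s
    proof -
      have S: "{b, a, c} = {a, b, c}" "{c, a, b} = {a, b, c}" by auto
      have B': "nb b \<union> nb a \<union> nb c \<subseteq> {r, s}" "nb c \<union> nb a \<union> nb b \<subseteq> {r, s}" using B by auto
      consider "\<not> N b r" "\<not> N c r" | "\<not> N a r" "\<not> N c r" | "\<not> N a r" "\<not> N b r" using n by blast
      then show ?thesis
      proof cases
        case 1
        then show ?thesis using packs_independent_two_outer[of a b c r s] V d indep indep' B r by simp
      next
        case 2
        then show ?thesis
          using packs_independent_two_outer[of b a c r s] V d indep indep' B' r by (simp add: S)
      next
        case 3
        then show ?thesis
          using packs_independent_two_outer[of c a b r s] V d indep indep' B' r by (simp add: S)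
      qed
    qed
    have uniq: "\<not> (N b p \<and> N b q)" "\<not> (N c p \<and> N c q)"
      using nbb nbc \<open>p \<noteq> q\<close> by (auto simp: nb set_eq_iff)
    \<comment> \<open>If each of \<open>p\<close> and \<open>q\<close> is missed by two members,
      counting forces \<open>a\<close> to miss both and \<open>b\<close>, \<open>c\<close> to miss
      one each. Then \<open>p\<close> and \<open>q\<close> have two nonneighbours, so they miss each
      other, which gives \<open>p\<close> a third.\<close>
    have no: "\<not> (N a p \<and> N a q \<and> N x p \<and> N y q)" if "x \<in> {b, c}" "y \<in> {b, c}" for x y
    proof
      assume *: "N a p \<and> N a q \<and> N x p \<and> N y q"
      then have N: "N p a" "N q a" "N p x" "N q y" using N_sym by blast+
      have "a \<noteq> x" "a \<noteq> y" using that d by auto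
      then have "N p q" using deg_2_adjacent[OF N(1) N(3) _ N(2) N(4) _ \<open>p \<noteq> q\<close>] by blast
      then show False using deg_le_2[OF N(1) N(3)] \<open>a \<noteq> x\<close> pq that by blast
    qed
    show ?thesis
    proof (rule ccontr)
      assume not: "\<not> ?thesis"
      have "\<not> (\<not> N b p \<and> \<not> N c p \<or> \<not> N a p \<and> \<not> N c p \<or> \<not> N a p \<and> \<not> N b p)"
        using fin[of p q] B \<open>p \<noteq> q\<close> pq not by blast
      moreover have "\<not> (\<not> N b q \<and> \<not> N c q \<or> \<not> N a q \<and> \<not> N c q \<or> \<not> N a q \<and> \<not> N b q)"
        using fin[of q p] B \<open>p \<noteq> q\<close> pq not by blast
      ultimately show False using uniq no[of b c] no[of c b] by blast
    qed
  qed
  \<comment> \<open>Three outer vertices miss exactly one member each, and each of the three inner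
    edges repairs one tree.\<close>
  have three: ?thesis if B: "nb a = {p, q}" "p \<noteq> q" "nb x = {r}" "nb y = {}" "{x, y} = {b, c}"
    "r \<notin> {p, q}" for p q r x y
  proof -
    have pqr: "p \<notin> {a, x, y}" "p \<in> verts G" "q \<notin> {a, x, y}" "q \<in> verts G" "r \<notin> {a, x, y}" "r \<in> verts G"
      using out[of p] out[of q] out[of r] B by (auto simp: doubleton_eq_iff)
    have xy: "x \<in> verts G" "y \<in> verts G" "a \<noteq> x" "a \<noteq> y" "x \<noteq> y"
      using B(5) V d by (auto simp: doubleton_eq_iff)
    have "packs G {a, x, y} (verts G) (card (verts G) - 3)"
      using V(1) xy pqr B(2,6)
      by (intro packs_build[where bs = "[p, q, r]" and
            tps = "[(a, [(a, x), (x, p), (p, y)]), (a, [(a, y), (y, q), (q, x)]),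
              (x, [(x, y), (y, r), (r, a)])]"])
         (auto simp: edge B(1,3,4) nbD[OF B(1)] nbD[OF B(3)] nbD[OF B(4)] doubleton_eq_iff)
    moreover have "{a, x, y} = {a, b, c}" using B(5) by auto
    ultimately show ?thesis by simp
  qed
  \<comment> \<open>Here \<open>p\<close> misses both \<open>a\<close> and \<open>x\<close>, so it
    is adjacent to \<open>r\<close>, and the star at \<open>r\<close> reaches \<open>y\<close>
    through \<open>p\<close>. Two inner edges form a tree, and the third attaches \<open>a\<close>
    to the path through \<open>q\<close>.\<close>
  have three': ?thesis if B: "nb a = {p, q}" "p \<noteq> q" "nb x = {p}" "nb y = {r}" "{x, y} = {b, c}"
    "r \<notin> {p, q}" for p q r x y
  proof -
    have pqr: "p \<notin> {a, x, y}" "p \<in> verts G" "q \<notin> {a, x, y}" "q \<in> verts G" "r \<notin> {a, x, y}" "r \<in> verts G"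
      using out[of p] out[of q] out[of r] B by (auto simp: doubleton_eq_iff)
    have xy: "x \<in> verts G" "y \<in> verts G" "a \<noteq> x" "a \<noteq> y" "x \<noteq> y"
      using B(5) V d by (auto simp: doubleton_eq_iff)
    have "N p a" "N p x" by (simp_all add: nbD[OF B(1)] nbD[OF B(3)])
    then have "\<not> N p r" using deg_le_2[of p a x r] xy pqr by blast
    then have "\<not> N p r" "\<not> N r p" using N_sym by blast+
    then have "packs G {a, x, y} (verts G) (card (verts G) - 3)"
      using V(1) xy pqr B(2,6)
      by (intro packs_build[where bs = "[p, q, r]" and
            tps = "[(x, [(x, y), (y, a)]), (y, [(y, q), (q, x), (x, a)]),
              (r, [(r, x), (r, a), (r, p), (p, y)])]"])
         (auto simp: edge B(1,3,4) nbD[OF B(1)] nbD[OF B(3)] nbD[OF B(4)] doubleton_eq_iff)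
    moreover have "{a, x, y} = {a, b, c}" using B(5) by auto
    ultimately show ?thesis by simp
  qed
  show ?thesis
  proof (cases rule: nb_cases[of a])
    case 1
    show ?thesis
    proof (cases "nb b \<union> nb c \<subseteq> {f} \<or> nb b \<union> nb c \<subseteq> {g}")
      case True
      then show ?thesis using one[of f] one[of g] 1 by auto
    next
      case False
      then show ?thesis using two[of f g] nbb nbc 1 by auto
    qed
  next
    case (2 p)
    show ?thesis
    proof (cases "nb b \<subseteq> {p} \<and> nb c \<subseteq> {p}")
      case True
      then show ?thesis using one[of p] 2 by auto
    next
      case notp: False
      show ?thesis
      proof (cases "nb b = {f} \<and> nb c = {g} \<and> f \<noteq> g \<and> p \<noteq> f \<and> p \<noteq> g")
        case True
        then have B: "nb b = {f}" "nb c = {g}" and ne: "f \<noteq> g" "p \<noteq> f" "p \<noteq> g" by auto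
        then show ?thesis
          using V d ne out[of p] out[of f] out[of g] 2
          by (intro packs_build[where bs = "[p, f, g]" and
                tps = "[(a, [(a, b), (b, p), (p, c)]), (b, [(b, c), (c, f), (f, a)]),
                  (c, [(c, a), (a, g), (g, b)])]"])
             (auto simp: edge nbD[OF 2] nbD[OF B(1)] nbD[OF B(2)] doubleton_eq_iff)
      next
        case False
        then have "nb a \<union> nb b \<union> nb c = {p, f} \<and> p \<noteq> f \<or> nb a \<union> nb b \<union> nb c = {p, g} \<and> p \<noteq> g"
          using notp nbb nbc 2 by auto
        then show ?thesis using two by blast
      qed
    qed
  next
    case pq: (3 p q)
    show ?thesis
    proof (cases "nb b \<union> nb c \<subseteq> {p, q}")
      case True
      then show ?thesis using two[of p q] pq by auto
    next
      case notsub: False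
      have a_nbs: "N a p" "N a q" by (simp_all add: nbD[OF pq(1)])
      have fg: "f \<noteq> g" if "nb b = {f}" "nb c = {g}"
      proof
        assume "f = g"
        then have N: "N f b" "N f c" by (simp_all add: nbD[OF that(1)] nbD[OF that(2)])
        have "a \<noteq> f" using out[of f] that by auto
        then have "N a f" using deg_2_adjacent[OF a_nbs pq(2) N d(3)] by blast
        then have "f \<in> {p, q}" by (simp add: nbD[OF pq(1)])
        then show False using that \<open>f = g\<close> notsub by auto
      qed
      consider "nb b = {f}" "nb c = {}" | "nb b = {}" "nb c = {g}" | "nb b = {f}" "nb c = {g}"
        using nbb nbc notsub by auto
      then show ?thesis
      proof cases
        case 1
        then show ?thesis using three[OF pq, of b f c] notsub by auto
      next
        case 2
        then show ?thesis using three[OF pq, of c g b] notsub by auto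
      next
        case B: 3
        have qp: "nb a = {q, p}" "q \<noteq> p" using pq by auto
        consider "f = p" | "f = q" | "g = p" | "g = q" | "f \<notin> {p, q}" "g \<notin> {p, q}" by blast
        then show ?thesis
        proof cases
          case 1
          then show ?thesis using three'[OF pq, of b c g] B notsub by auto
        next
          case 2
          then show ?thesis using three'[OF qp, of b c g] B notsub by auto
        next
          case 3
          then show ?thesis using three'[OF pq, of c b f] B notsub by auto
        next
          case 4
          then show ?thesis using three'[OF qp, of c b f] B notsub by auto
        next
          case 5
          \<comment> \<open>Four outer vertices miss one member each. Two inner edges form a tree,
            the third repairs the tree through \<open>p\<close>, and \<open>q\<close> is a bridge
            from \<open>f\<close> to \<open>b\<close> and from \<open>g\<close> to \<open>c\<close>.
            If \<open>f\<close> missed \<open>q\<close> besides \<open>b\<close>, it would also miss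
            \<open>a\<close>, although \<open>f\<close> is neither \<open>p\<close> nor
            \<open>q\<close>; the same holds for \<open>g\<close>.\<close>
          have "N f b" "N g c" by (simp_all add: nbD[OF B(1)] nbD[OF B(2)])
          have ne: "a \<noteq> f" "a \<noteq> g" "b \<noteq> q" "c \<noteq> q"
            using out[of f] out[of g] out[of q] B pq by auto
          have "\<not> N f q"
            using deg_2_adjacent[OF a_nbs pq(2) \<open>N f b\<close> _ ne(3,1)] 5 by (auto simp: nbD[OF pq(1)])
          moreover have "\<not> N g q"
            using deg_2_adjacent[OF a_nbs pq(2) \<open>N g c\<close> _ ne(4,2)] 5 by (auto simp: nbD[OF pq(1)])
          ultimately have "\<not> N f q" "\<not> N g q" "\<not> N q f" "\<not> N q g" using N_sym by blast+
          then show ?thesis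
            using V d fg[OF B] 5 out[of p] out[of f] out[of g] out[of q] pq B
            by (intro packs_build[where bs = "[p, q, f, g]" and
                  tps = "[(a, [(a, b), (b, c)]), (a, [(a, c), (c, p), (p, b)]),
                    (f, [(f, a), (f, c), (f, q), (q, b)]), (g, [(g, a), (g, b), (g, q), (q, c)])]"])
               (auto simp: edge nbD[OF pq(1)] nbD[OF B(1)] nbD[OF B(2)] doubleton_eq_iff)
        qed
      qed
    qed
  qed
qed

lemma packs_thin:
  assumes "a \<in> verts G" "b \<in> verts G" "c \<in> verts G" "a \<noteq> b" "a \<noteq> c" "b \<noteq> c"
  shows "packs G {a, b, c} (verts G) (card (verts G) - 3)"
proof -
  have S: "{b, a, c} = {a, b, c}" "{a, c, b} = {a, b, c}" "{b, c, a} = {a, b, c}" "{c, a, b} = {a, b, c}"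
    by auto
  consider "N a b" "N b c" | "N b a" "N a c" | "N a c" "N c b"
    | "N a b" "\<not> N a c" "\<not> N b c" | "N a c" "\<not> N a b" "\<not> N c b" | "N b c" "\<not> N b a" "\<not> N c a"
    | "\<not> N a b" "\<not> N a c" "\<not> N b c"
    using N_sym by blast
  then show ?thesis
  proof cases
    case 1
    then show ?thesis using packs_path_nonedges[of a b c] assms by simp
  next
    case 2
    then show ?thesis using packs_path_nonedges[of b a c] assms by (simp add: S)
  next
    case 3
    then show ?thesis using packs_path_nonedges[of a c b] assms by (simp add: S)
  next
    case 4
    then show ?thesis using packs_one_nonedge[of a b c] assms by simp
  next
    case 5
    then show ?thesis using packs_one_nonedge[of a c b] assms by (simp add: S)
  next
    case 6
    then show ?thesis using packs_one_nonedge[of b c a] assms by (simp add: S)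
  next
    case indep: 7
    then have indep': "\<not> N b a" "\<not> N c a" "\<not> N c b" using N_sym by blast+
    have le1: "(\<exists>f. nb x = {} \<or> nb x = {f}) \<or> (\<exists>d e. N x d \<and> N x e \<and> d \<noteq> e)" for x
      unfolding nb by blast
    \<comment> \<open>Adjacent vertices cannot both have two nonneighbours. So a vertex of the
      triple that has two can take the role of \<open>a\<close> in
      \<open>packs_independent_aux\<close>.\<close>
    have small: "\<exists>f. nb y = {} \<or> nb y = {f}" if "N x d" "N x e" "d \<noteq> e" "\<not> N x y" "x \<noteq> y" for x y d e
      using le1[of y] deg_2_adjacent[OF that(1-3), of y] that(4,5) by blast
    show ?thesis
    proof (cases "(\<exists>f. nb b = {} \<or> nb b = {f}) \<and> (\<exists>g. nb c = {} \<or> nb c = {g})")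
      case True
      then show ?thesis using packs_independent_aux[of a b c] assms indep by auto
    next
      case False
      then consider d e where "N b d" "N b e" "d \<noteq> e" | d e where "N c d" "N c e" "d \<noteq> e"
        using le1 by metis
      then show ?thesis
      proof cases
        case 1
        then have "\<exists>f. nb a = {} \<or> nb a = {f}" "\<exists>f. nb c = {} \<or> nb c = {f}"
          using small[OF 1, of a] small[OF 1, of c] assms indep indep' by auto
        then show ?thesis using packs_independent_aux[of b a c] assms indep indep' by (auto simp: S)
      next
        case 2
        then have "\<exists>f. nb a = {} \<or> nb a = {f}" "\<exists>f. nb b = {} \<or> nb b = {f}"
          using small[OF 2, of a] small[OF 2, of b] assms indep indep' by auto
        then show ?thesis using packs_independent_aux[of c a b] assms indep indep' by (auto simp: S)
      qed
    qed
  qed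
qed

section \<open>One more tree when there is at most one nonedge\<close>

text \<open>No outer vertex is defective, so all of them carry stars and the inner path through
  \<open>c\<close> is a surplus tree.\<close>

lemma packs_inner:
  assumes "a \<in> verts G" "b \<in> verts G" "c \<in> verts G" "a \<noteq> b" "a \<noteq> c" "b \<noteq> c"
    and "\<not> N a c" "\<not> N c b" "nb a \<union> nb b \<union> nb c \<subseteq> {a, b, c}"
  shows "packs G {a, b, c} (verts G) (card (verts G) - 3 + 1)"
  using assms
  by (intro packs_build_plus[where bs = "[]" and tps = "[(a, [(a, c), (c, b)])]"]) (auto simp: edge)

text \<open>Two inner edges form the surplus tree; the third attaches \<open>a\<close> to the path
  through \<open>d\<close>, which misses only \<open>a\<close>.\<close>

lemma packs_one_outer:
  assumes V: "a \<in> verts G" "b \<in> verts G" "c \<in> verts G" "a \<noteq> b" "a \<noteq> c" "b \<noteq> c"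
    and nbs: "nb a = {d}" "nb b = {}" "nb c = {}"
  shows "packs G {a, b, c} (verts G) (card (verts G) - 3 + 1)"
proof -
  have N: "N a d" "N d a" by (simp_all add: nbD[OF nbs(1)])
  have d: "d \<in> verts G" "d \<noteq> a" "d \<noteq> b" "d \<noteq> c"
    using N_verts[OF N(1)] N N_irrefl by (auto simp: nbD[OF nbs(2)] nbD[OF nbs(3)])
  show ?thesis
    using V d
    by (intro packs_build_plus[where bs = "[d]" and
          tps = "[(a, [(a, c), (c, b)]), (a, [(a, b), (b, d), (d, c)])]"])
       (auto simp: edge nbs nbD[OF nbs(1)] nbD[OF nbs(2)] nbD[OF nbs(3)] doubleton_eq_iff)
qed

text \<open>If the only nonedge lies inside the triple or avoids it, some inner path survives and no
  outer vertex is defective. If it has one end in the triple, its other end is the only defective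
  vertex.\<close>

lemma packs_few_nonedges:
  assumes V: "a \<in> verts G" "b \<in> verts G" "c \<in> verts G" "a \<noteq> b" "a \<noteq> c" "b \<noteq> c"
    and uniq: "\<And>x y x' y'. N x y \<Longrightarrow> N x' y' \<Longrightarrow> {x, y} = {x', y'}"
  shows "packs G {a, b, c} (verts G) (card (verts G) - 3 + 1)"
proof -
  have nb1: "nb x = {y}" if "N x y" for x y
    using uniq[OF that] that by (auto simp: nb doubleton_eq_iff)
  have nb0: "nb z = {}" if "N x y" "z \<noteq> x" "z \<noteq> y" for x y z
    using uniq[OF that(1)] that by (fastforce simp: nb doubleton_eq_iff)
  have inner: "packs G {x, y, z} (verts G) (card (verts G) - 3 + 1)"
    if "x \<in> verts G" "y \<in> verts G" "z \<in> verts G" "x \<noteq> y" "x \<noteq> z" "y \<noteq> z" "N x y" for x y z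
    using that nb0[OF that(7), of z] nb1[OF that(7)] nb1[OF N_sym[OF that(7)]]
    by (intro packs_inner) (auto simp: nb)
  have outer: "packs G {x, y, z} (verts G) (card (verts G) - 3 + 1)"
    if "x \<in> verts G" "y \<in> verts G" "z \<in> verts G" "x \<noteq> y" "x \<noteq> z" "y \<noteq> z" "N x d" "d \<noteq> y" "d \<noteq> z" for x y z d
    using that nb0[OF that(7), of y] nb0[OF that(7), of z] nb1[OF that(7)]
    by (intro packs_one_outer[where d = d]) auto
  have S: "{b, c, a} = {a, b, c}" "{c, a, b} = {a, b, c}" "{a, c, b} = {a, b, c}" by auto
  show ?thesis
  proof (cases "nb a \<union> nb b \<union> nb c = {}")
    case True
    then show ?thesis using V by (intro packs_inner) (auto simp: nb)
  next
    case False
    then obtain d where "N a d \<or> N b d \<or> N c d" by (auto simp: nb)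
    then consider "N a b" | "N a c" | "N b c" | "N a d" "d \<noteq> b" "d \<noteq> c" | "N b d" "d \<noteq> a" "d \<noteq> c"
      | "N c d" "d \<noteq> a" "d \<noteq> b"
      using N_sym by metis
    then show ?thesis
    proof cases
      case 1
      then show ?thesis using inner[of a b c] V by simp
    next
      case 2
      then show ?thesis using inner[of a c b] V by (simp add: S)
    next
      case 3
      then show ?thesis using inner[of b c a] V by (simp add: S)
    next
      case 4
      then show ?thesis using outer[of a b c d] V by simp
    next
      case 5
      then show ?thesis using outer[of b c a d] V by (simp add: S)
    next
      case 6
      then show ?thesis using outer[of c a b d] V by (simp add: S)
    qed
  qed
qed

end

section \<open>The value of \<open>gen_lambda 3\<close>\<close>

lemma degree_le:
  assumes G: "simple_graph G" and u: "u \<in> verts G" and D: "\<And>x. x \<in> D \<Longrightarrow> {u, x} \<in> edges (complement G)"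
  shows "card {e \<in> edges G. u \<in> e} \<le> card (verts G) - 1 - card D"
proof -
  have fin: "finite (verts G)" using G by (simp add: simple_graph_def)
  have DV: "D \<subseteq> verts G - {u}"
  proof
    fix x assume "x \<in> D"
    then have "{u, x} \<subseteq> verts G" "card {u, x} = 2" using D[of x] by (auto simp: complement_def)
    then show "x \<in> verts G - {u}" by auto
  qed
  have "{e \<in> edges G. u \<in> e} \<subseteq> (\<lambda>x. {u, x}) ` (verts G - {u} - D)"
  proof
    fix e assume e: "e \<in> {e \<in> edges G. u \<in> e}"
    then have "e \<subseteq> verts G" "card e = 2" using G by (auto simp: simple_graph_def)
    then obtain x where x: "e = {u, x}" "x \<noteq> u" using e by (auto simp: card_2_iff)
    then have "x \<notin> D" using D[of x] e by (auto simp: complement_def)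
    then show "e \<in> (\<lambda>x. {u, x}) ` (verts G - {u} - D)" using x \<open>e \<subseteq> verts G\<close> by auto
  qed
  then have "card {e \<in> edges G. u \<in> e} \<le> card (verts G - {u} - D)"
    using fin by (meson card_image_le card_mono finite_Diff finite_imageI le_trans)
  also have "\<dots> = card (verts G) - 1 - card D"
    using DV fin u by (simp add: card_Diff_subset finite_subset)
  finally show ?thesis .
qed

lemma gen_lambda_le:
  assumes "simple_graph G" "connected_graph G" "S \<subseteq> verts G" "card S = k"
    and "\<And>\<T>. tree_packing G S \<T> \<Longrightarrow> card \<T> \<le> m"
  shows "gen_lambda k G \<le> m"
proof -
  have "k \<le> card (verts G)" using assms card_mono by (auto simp: simple_graph_def)
  then have "gen_lambda k G \<le> local_lambda G S"
    using assms gen_lambda_well_defined(1)[of G k] by (auto simp: gen_lambda_def intro!: Min_le)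
  also have "\<dots> \<le> m" using local_lambda_packing[OF assms(1)] assms(5) by metis
  finally show ?thesis .
qed

lemma gen_lambda_ge:
  assumes "simple_graph G" "connected_graph G" "k \<le> card (verts G)"
    and "\<And>S. S \<subseteq> verts G \<Longrightarrow> card S = k \<Longrightarrow> packs G S (verts G) m"
  shows "m \<le> gen_lambda k G"
  using assms gen_lambda_well_defined[OF assms(1,3)] packs_le_local_lambda[OF assms(1)]
  by (auto simp: gen_lambda_def)

text \<open>A complement that is not thin brings the value below \<open>card (verts G) - 3\<close>,
  and a thin one with at most one edge brings it above; a thin one with two edges is caught between
  both bounds.\<close>

lemma gen_lambda_3_eq_iff:
  assumes G: "simple_graph G" and conn: "connected_graph G" and n: "card (verts G) \<ge> 3"
  shows "gen_lambda 3 G = card (verts G) - 3 \<longleftrightarrow>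
    thin_graph (complement G) \<and> (\<exists>e\<in>edges (complement G). \<exists>e'\<in>edges (complement G). e \<noteq> e')"
proof -
  let ?n = "card (verts G)"
  define N where "N x y \<longleftrightarrow> {x, y} \<in> edges (complement G)" for x y
  have N_sym: "N y x" if "N x y" for x y using that by (simp add: N_def insert_commute)
  have NV: "x \<in> verts G \<and> y \<in> verts G \<and> x \<noteq> y" if "N x y" for x y
    using that by (auto simp: N_def complement_def)
  have edge: "{x, y} \<in> edges G" if "x \<in> verts G" "y \<in> verts G" "x \<noteq> y" "\<not> N x y" for x y
    using that by (auto simp: N_def complement_def)
  have deg: "card {e \<in> edges G. u \<in> e} \<le> ?n - 1 - card D" if "u \<in> verts G" "\<And>x. x \<in> D \<Longrightarrow> N u x" for u D
    using degree_le[OF G] that by (simp add: N_def)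
  have card_le: "card A \<le> ?n" if "A \<subseteq> verts G" for A
    using card_mono[OF _ that] G by (simp add: simple_graph_def)
  have by_degree: "gen_lambda 3 G \<le> ?n - 1 - card D"
    if "x \<in> D" "y \<in> D" "x \<noteq> y" "\<And>x. x \<in> D \<Longrightarrow> N u x" for u x y D
  proof -
    have V: "u \<in> verts G" "x \<in> verts G" "y \<in> verts G" "u \<noteq> x" "u \<noteq> y"
      using NV[OF that(4)[OF that(1)]] NV[OF that(4)[OF that(2)]] by auto
    show ?thesis
    proof (rule gen_lambda_le[OF G conn, of "{u, x, y}"])
      fix \<T> assume "tree_packing G {u, x, y} \<T>"
      then have "card \<T> \<le> card {e \<in> edges G. u \<in> e}"
        using tree_packing_card_le_degree[OF G, of "{u, x, y}" \<T> u x] V by auto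
      also have "\<dots> \<le> ?n - 1 - card D" using deg[OF V(1)] that(4) by blast
      finally show "card \<T> \<le> ?n - 1 - card D" .
    qed (use V that(3) in auto)
  qed
  \<comment> \<open>The triple is completed by a nonneighbour \<open>x\<close> of \<open>u\<close>,
    which differs from \<open>v\<close> because \<open>u\<close> and \<open>v\<close> are adjacent
    in \<open>G\<close>.\<close>
  have by_pair: "gen_lambda 3 G < d"
    if uv: "u \<noteq> v" "\<not> N u v" "N u x" "v \<in> verts G"
      and d: "card {e \<in> edges G. u \<in> e} \<le> d" "card {e \<in> edges G. v \<in> e} \<le> d" for u v x d
  proof -
    have V: "u \<in> verts G" "x \<in> verts G" "u \<noteq> x" "v \<noteq> x" using NV[OF uv(3)] uv by auto
    have less: "card \<T> < d" if "tree_packing G {u, v, x} \<T>" for \<T>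
      using tree_packing_card_less[OF G that, of u v x d] V uv d edge by auto
    \<comment> \<open>The empty packing already gives \<open>0 < d\<close>, so that
      \<open>d - 1\<close> is a true predecessor.\<close>
    have "tree_packing G {u, v, x} {}" by (simp add: tree_packing_def)
    then have "0 < d" using less by fastforce
    moreover have "gen_lambda 3 G \<le> d - 1"
      using less V uv by (intro gen_lambda_le[OF G conn, of "{u, v, x}"]) fastforce+
    ultimately show ?thesis by simp
  qed
  show ?thesis
  proof (cases "thin_graph (complement G)")
    case False
    then consider v x y z where "N v x" "N v y" "N v z" "x \<noteq> y" "x \<noteq> z" "y \<noteq> z"
      | u v x y x' y' where "N u x" "N u y" "x \<noteq> y" "N v x'" "N v y'" "x' \<noteq> y'" "u \<noteq> v" "\<not> N u v"
      unfolding thin_graph_def N_def by blast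
    then have "gen_lambda 3 G < ?n - 3"
    proof cases
      case 1
      \<comment> \<open>Four vertices are needed for a strict inequality: at \<open>?n = 3\<close>
        both \<open>?n - 4\<close> and \<open>?n - 3\<close> would be 0.\<close>
      have "card {v, x, y, z} \<le> ?n" using NV[OF 1(1)] NV[OF 1(2)] NV[OF 1(3)] by (intro card_le) auto
      moreover have "v \<noteq> x" "v \<noteq> y" "v \<noteq> z" using NV 1 by blast+
      ultimately have "4 \<le> ?n" using 1 by simp
      moreover have "gen_lambda 3 G \<le> ?n - 1 - card {x, y, z}"
        using by_degree[of x "{x, y, z}" y v] 1 by auto
      ultimately show ?thesis using 1 by simp
    next
      case 2
      have "card {e \<in> edges G. u \<in> e} \<le> ?n - 1 - card {x, y}"
        using NV[OF 2(1)] 2 by (intro deg) auto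
      moreover have "card {e \<in> edges G. v \<in> e} \<le> ?n - 1 - card {x', y'}"
        using NV[OF 2(4)] 2 by (intro deg) auto
      ultimately show ?thesis
        using 2 by_pair[of u v x "?n - 3"] NV[OF 2(4)] by simp
    qed
    then show ?thesis using False by simp
  next
    case thin: True
    interpret thin_complement G N "\<lambda>x. {y. N x y}"
      by unfold_locales (simp_all add: G thin N_def)
    have lower: "?n - 3 \<le> gen_lambda 3 G"
    proof (rule gen_lambda_ge[OF G conn n])
      fix S assume "S \<subseteq> verts G" "card S = 3"
      then show "packs G S (verts G) (?n - 3)"
        using packs_thin by (auto simp: card_3_iff)
    qed
    show ?thesis
    proof (cases "\<exists>e\<in>edges (complement G). \<exists>e'\<in>edges (complement G). e \<noteq> e'")
      case False
      have "?n - 3 + 1 \<le> gen_lambda 3 G"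
      proof (rule gen_lambda_ge[OF G conn n])
        fix S assume S: "S \<subseteq> verts G" "card S = 3"
        obtain a b c where abc: "S = {a, b, c}" "a \<noteq> b" "a \<noteq> c" "b \<noteq> c"
          using S(2) by (auto simp: card_3_iff)
        have "e = e'" if "e \<in> edges (complement G)" "e' \<in> edges (complement G)" for e e'
          using that False by metis
        then have uniq: "{x, y} = {x', y'}" if "N x y" "N x' y'" for x y x' y'
          using that by (simp only: N_def)
        have "a \<in> verts G" "b \<in> verts G" "c \<in> verts G" using S(1) abc(1) by auto
        from packs_few_nonedges[OF this abc(2-4) uniq]
        show "packs G S (verts G) (?n - 3 + 1)" by (simp only: abc(1))
      qed
      then show ?thesis using False by simp
    next
      case True
      then obtain e e' where e: "e \<in> edges (complement G)" "e' \<in> edges (complement G)" "e \<noteq> e'" by blast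
      then obtain a b c d where ab: "e = {a, b}" "e' = {c, d}"
        unfolding complement_def by (auto simp: card_2_iff)
      then have N1: "N a b" "N c d" "{a, b} \<noteq> {c, d}" using e by (auto simp: N_def)
      \<comment> \<open>Either some vertex has two nonneighbours, hence degree at most
        \<open>?n - 3\<close> in \<open>G\<close>, or the two nonedges are disjoint. Then their ends
        \<open>a\<close> and \<open>c\<close> are adjacent in \<open>G\<close> with degrees at most
        \<open>?n - 2\<close>, and adjacency costs one more tree.\<close>
      have "gen_lambda 3 G \<le> ?n - 3"
      proof (cases "\<exists>u x y. N u x \<and> N u y \<and> x \<noteq> y")
        case True
        then obtain u x y where u: "N u x" "N u y" "x \<noteq> y" by blast
        have "gen_lambda 3 G \<le> ?n - 1 - card {x, y}"
          by (rule by_degree[of x _ y u]) (use u in auto)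
        then show ?thesis using u(3) by simp
      next
        case False
        then have dist: "\<not> N a c" "a \<noteq> c" using N1 N_sym[OF N1(1)] N_sym[OF N1(2)] by blast+
        have "card {e \<in> edges G. a \<in> e} \<le> ?n - 1 - card {b}"
          using NV[OF N1(1)] N1 by (intro deg) auto
        moreover have "card {e \<in> edges G. c \<in> e} \<le> ?n - 1 - card {d}"
          using NV[OF N1(2)] N1 by (intro deg) auto
        ultimately have "gen_lambda 3 G < ?n - 2"
          using dist N1 NV[OF N1(2)] by (intro by_pair[of a c b]) (simp_all add: numeral_2_eq_2)
        then show ?thesis by simp
      qed
      then show ?thesis using lower thin True by auto
    qed
  qed
qed

section \<open>Thin graphs up to isomorphism\<close>

text \<open>The given map runs against the direction of the isomorphism, from the model
  \<open>K\<close> into \<open>H\<close>, because the vertices of the model are explicit.\<close>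

lemma graph_isoI:
  assumes "bij_betw g (verts K) (verts H)"
    and "\<And>u v. u \<in> verts K \<Longrightarrow> v \<in> verts K \<Longrightarrow> {u, v} \<in> edges K \<longleftrightarrow> {g u, g v} \<in> edges H"
  shows "H \<simeq>\<^sub>g K"
proof -
  let ?f = "inv_into (verts K) g"
  have f: "bij_betw ?f (verts H) (verts K)" using assms(1) by (rule bij_betw_inv_into)
  have "?f u \<in> verts K" "g (?f u) = u" if "u \<in> verts H" for u
    using that f assms(1) bij_betwE bij_betw_inv_into_right by fastforce+
  then show ?thesis
    unfolding graph_iso_def using f assms(2) by (intro exI[of _ ?f]) auto
qed

section \<open>Thinness of the four families\<close>

definition matching_graph :: "'a ugraph \<Rightarrow> bool" where
  "matching_graph H \<longleftrightarrow> (\<forall>v x y. {v, x} \<in> edges H \<longrightarrow> {v, y} \<in> edges H \<longrightarrow> x = y)"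

lemma matching_graphD: "matching_graph H \<Longrightarrow> {v, x} \<in> edges H \<Longrightarrow> {v, y} \<in> edges H \<Longrightarrow> x = y"
  unfolding matching_graph_def by metis

lemma matching_imp_thin:
  assumes "matching_graph H"
  shows "thin_graph H"
proof (rule thin_graphI)
  fix v x y z assume "{v, x} \<in> edges H" "{v, y} \<in> edges H"
  then have "x = y" by (rule matching_graphD[OF assms])
  then show "x = y \<or> x = z \<or> y = z" by simp
next
  fix u v x y assume "{u, x} \<in> edges H" "{u, y} \<in> edges H" "x \<noteq> y"
  then show "{u, v} \<in> edges H" using matching_graphD[OF assms] by metis
qed

lemma edges_disjoint_union:
  fixes A :: "'a ugraph" and B :: "'b ugraph"
  shows "{p, q} \<in> edges (A \<union>\<^sub>g B) \<longleftrightarrow>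
    (\<exists>u v. p = Inl u \<and> q = Inl v \<and> {u, v} \<in> edges A) \<or> (\<exists>u v. p = Inr u \<and> q = Inr v \<and> {u, v} \<in> edges B)"
    (is "?L \<longleftrightarrow> ?R")
proof
  assume ?L
  then consider e where "e \<in> edges A" "{p, q} = Inl ` e" | e where "e \<in> edges B" "{p, q} = Inr ` e"
    by (auto simp: disjoint_union_def)
  then show ?R
  proof cases
    case 1
    then have "p \<in> Inl ` e" "q \<in> Inl ` e" by (metis insertCI)+
    then obtain u v where uv: "p = Inl u" "q = Inl v" by auto
    have "(Inl ` {u, v} :: ('a + 'b) set) = Inl ` e" using 1(2) uv by simp
    then have "e = {u, v}" by (simp only: inj_image_eq_iff[OF inj_Inl])
    then show ?thesis using 1(1) uv by blast
  next
    case 2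
    then have "p \<in> Inr ` e" "q \<in> Inr ` e" by (metis insertCI)+
    then obtain u v where uv: "p = Inr u" "q = Inr v" by auto
    have "(Inr ` {u, v} :: ('a + 'b) set) = Inr ` e" using 2(2) uv by simp
    then have "e = {u, v}" by (simp only: inj_image_eq_iff[OF inj_Inr])
    then show ?thesis using 2(1) uv by blast
  qed
next
  assume ?R
  then consider u v where "p = Inl u" "q = Inl v" "{u, v} \<in> edges A"
    | u v where "p = Inr u" "q = Inr v" "{u, v} \<in> edges B"
    by blast
  then show ?L
  proof cases
    case 1
    then have "{p, q} \<in> (`) Inl ` edges A" by (intro image_eqI[of _ _ "{u, v}"]) simp_all
    then show ?thesis by (simp add: disjoint_union_def)
  next
    case 2
    then have "{p, q} \<in> (`) Inr ` edges B" by (intro image_eqI[of _ _ "{u, v}"]) simp_all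
    then show ?thesis by (simp add: disjoint_union_def)
  qed
qed

lemma edges_copies: "{p, q} \<in> edges (m \<cdot>\<^sub>g H) \<longleftrightarrow> fst p < m \<and> fst q = fst p \<and> {snd p, snd q} \<in> edges H"
    (is "?L \<longleftrightarrow> ?R")
proof
  assume ?L
  then obtain i e where e: "i < m" "e \<in> edges H" "{p, q} = Pair i ` e" by (auto simp: copies_def)
  then have "p \<in> Pair i ` e" "q \<in> Pair i ` e" by (metis insertCI)+
  then have pq: "fst p = i" "fst q = i" by auto
  have "{snd p, snd q} = snd ` {p, q}" by simp
  also have "\<dots> = e" by (simp only: e(3) image_image snd_conv image_ident)
  finally show ?R using e pq by simp
next
  assume R: ?R
  then have "{p, q} = Pair (fst p) ` {snd p, snd q}" by (cases p; cases q) simp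
  then show ?L using R unfolding copies_def snd_conv by blast
qed

lemma edges_path_graph: "{u, v} \<in> edges (path_graph m) \<longleftrightarrow> u = Suc v \<and> u < m \<or> v = Suc u \<and> v < m"
  by (auto simp: path_graph_def doubleton_eq_iff)

lemma edges_complete_graph: "{u, v} \<in> edges (complete_graph m) \<longleftrightarrow> u < m \<and> v < m \<and> u \<noteq> v"
  by (auto simp: complete_graph_def)

lemma edges_cycle_graph_3: "{u, v} \<in> edges (cycle_graph 3) \<longleftrightarrow> u < 3 \<and> v < 3 \<and> u \<noteq> v"
proof -
  have "{..<3} = {0, 1, 2 :: nat}" by auto
  moreover have "edges (cycle_graph 3) = (\<lambda>i. {i, Suc i mod 3}) ` {..<3}"
    by (auto simp: cycle_graph_def)
  ultimately have E: "edges (cycle_graph 3) = {{0, 1}, {1, 2}, {2, 0}}"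
    by (simp add: numeral_2_eq_2)
  have less_3: "w < 3 \<longleftrightarrow> w = 0 \<or> w = 1 \<or> w = 2" for w :: nat by auto
  show ?thesis unfolding E less_3 by (simp add: doubleton_eq_iff) linarith
qed

lemma matching_disjoint_union:
  assumes A: "matching_graph A" and B: "matching_graph B"
  shows "matching_graph (A \<union>\<^sub>g B)"
  unfolding matching_graph_def
proof (intro allI impI)
  fix v x y assume *: "{v, x} \<in> edges (A \<union>\<^sub>g B)" "{v, y} \<in> edges (A \<union>\<^sub>g B)"
  show "x = y"
  proof (cases v)
    case (Inl a)
    then obtain p q where "x = Inl p" "y = Inl q" "{a, p} \<in> edges A" "{a, q} \<in> edges A"
      using * by (auto simp: edges_disjoint_union)
    then show ?thesis using matching_graphD[OF A, of a p q] by simp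
  next
    case (Inr a)
    then obtain p q where "x = Inr p" "y = Inr q" "{a, p} \<in> edges B" "{a, q} \<in> edges B"
      using * by (auto simp: edges_disjoint_union)
    then show ?thesis using matching_graphD[OF B, of a p q] by simp
  qed
qed

lemma matching_copies:
  assumes "matching_graph H"
  shows "matching_graph (m \<cdot>\<^sub>g H)"
  unfolding matching_graph_def
proof (intro allI impI)
  fix v x y assume "{v, x} \<in> edges (m \<cdot>\<^sub>g H)" "{v, y} \<in> edges (m \<cdot>\<^sub>g H)"
  then have "fst x = fst y" "{snd v, snd x} \<in> edges H" "{snd v, snd y} \<in> edges H"
    by (simp_all add: edges_copies)
  then show "x = y" using matching_graphD[OF assms] prod_eqI by metis
qed

lemma matching_pairs_and_points: "matching_graph ((t \<cdot>\<^sub>g path_graph 2) \<union>\<^sub>g (k \<cdot>\<^sub>g complete_graph 1))"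
proof -
  have "matching_graph (path_graph 2)" "matching_graph (complete_graph 1)"
    by (auto simp: matching_graph_def edges_path_graph edges_complete_graph)
  then show ?thesis by (intro matching_disjoint_union matching_copies)
qed

text \<open>All vertices with two neighbours lie in \<open>A\<close>, since \<open>B\<close> has
  none.\<close>

lemma thin_disjoint_union:
  assumes A: "thin_graph A" and B: "matching_graph B"
  shows "thin_graph (A \<union>\<^sub>g B)"
proof (rule thin_graphI)
  fix v x y z
  assume *: "{v, x} \<in> edges (A \<union>\<^sub>g B)" "{v, y} \<in> edges (A \<union>\<^sub>g B)" "{v, z} \<in> edges (A \<union>\<^sub>g B)"
  show "x = y \<or> x = z \<or> y = z"
  proof (cases v)
    case (Inl a)
    then obtain p q r where "x = Inl p" "y = Inl q" "z = Inl r"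
      "{a, p} \<in> edges A" "{a, q} \<in> edges A" "{a, r} \<in> edges A"
      using * by (auto simp: edges_disjoint_union)
    then show ?thesis using thin_graphD(1)[OF A, of a p q r] by simp
  next
    case (Inr a)
    then obtain p q where "x = Inr p" "y = Inr q" "{a, p} \<in> edges B" "{a, q} \<in> edges B"
      using *(1,2) by (auto simp: edges_disjoint_union)
    then show ?thesis using matching_graphD[OF B, of a p q] by simp
  qed
next
  have left: "\<exists>w p q. u = Inl w \<and> {w, p} \<in> edges A \<and> {w, q} \<in> edges A \<and> p \<noteq> q"
    if *: "{u, x} \<in> edges (A \<union>\<^sub>g B)" "{u, y} \<in> edges (A \<union>\<^sub>g B)" and "x \<noteq> y" for u x y
  proof (cases u)
    case (Inl a)
    then show ?thesis using that by (auto simp: edges_disjoint_union)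
  next
    case (Inr a)
    then obtain p q where "x = Inr p" "y = Inr q" "{a, p} \<in> edges B" "{a, q} \<in> edges B"
      using * by (auto simp: edges_disjoint_union)
    then show ?thesis using matching_graphD[OF B, of a p q] \<open>x \<noteq> y\<close> by simp
  qed
  fix u v x y x' y'
  assume *: "{u, x} \<in> edges (A \<union>\<^sub>g B)" "{u, y} \<in> edges (A \<union>\<^sub>g B)" "x \<noteq> y"
    "{v, x'} \<in> edges (A \<union>\<^sub>g B)" "{v, y'} \<in> edges (A \<union>\<^sub>g B)" "x' \<noteq> y'" and uv: "u \<noteq> v"
  obtain a p q where a: "u = Inl a" "{a, p} \<in> edges A" "{a, q} \<in> edges A" "p \<noteq> q"
    using left[OF *(1-3)] by blast
  obtain b p' q' where b: "v = Inl b" "{b, p'} \<in> edges A" "{b, q'} \<in> edges A" "p' \<noteq> q'"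
    using left[OF *(4-6)] by blast
  have "{a, b} \<in> edges A" using thin_graphD(2)[OF A a(2-4) b(2-4)] uv a(1) b(1) by simp
  then show "{u, v} \<in> edges (A \<union>\<^sub>g B)" using a(1) b(1) by (simp add: edges_disjoint_union)
qed

text \<open>The vertices with two neighbours are the interior ones; a path on at most four vertices
  has at most two of them, and these are consecutive.\<close>

lemma thin_path_graph:
  assumes "m \<le> 4"
  shows "thin_graph (path_graph m)"
proof (rule thin_graphI)
  fix v x y z
  assume "{v, x} \<in> edges (path_graph m)" "{v, y} \<in> edges (path_graph m)" "{v, z} \<in> edges (path_graph m)"
  then show "x = y \<or> x = z \<or> y = z" unfolding edges_path_graph by auto
next
  have mid: "0 < u \<and> Suc u < m"
    if "{u, x} \<in> edges (path_graph m)" "{u, y} \<in> edges (path_graph m)" "x \<noteq> y" for u x y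
    using that unfolding edges_path_graph by auto
  fix u v x y x' y'
  assume *: "{u, x} \<in> edges (path_graph m)" "{u, y} \<in> edges (path_graph m)" "x \<noteq> y"
    "{v, x'} \<in> edges (path_graph m)" "{v, y'} \<in> edges (path_graph m)" "x' \<noteq> y'" "u \<noteq> v"
  show "{u, v} \<in> edges (path_graph m)"
    using mid[OF *(1-3)] mid[OF *(4-6)] *(7) assms unfolding edges_path_graph by linarith
qed

lemma thin_cycle_graph_3: "thin_graph (cycle_graph 3)"
proof (rule thin_graphI)
  fix v x y z
  assume *: "{v, x} \<in> edges (cycle_graph 3)" "{v, y} \<in> edges (cycle_graph 3)" "{v, z} \<in> edges (cycle_graph 3)"
  show "x = y \<or> x = z \<or> y = z"
  proof (rule ccontr)
    assume "\<not> ?thesis"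
    then have "card {v, x, y, z} = 4" using * by (auto simp: edges_cycle_graph_3)
    moreover have "card {v, x, y, z} \<le> card {..<3::nat}"
      using * by (intro card_mono) (auto simp: edges_cycle_graph_3)
    ultimately show False by simp
  qed
qed (auto simp: edges_cycle_graph_3)

lemma iso_thin:
  assumes iso: "H \<simeq>\<^sub>g K" and H: "simple_graph H" and K: "thin_graph K"
  shows "thin_graph H"
proof -
  obtain f where f: "bij_betw f (verts H) (verts K)"
    and e: "\<And>u v. u \<in> verts H \<Longrightarrow> v \<in> verts H \<Longrightarrow> {u, v} \<in> edges H \<longleftrightarrow> {f u, f v} \<in> edges K"
    using iso unfolding graph_iso_def by metis
  have V: "u \<in> verts H" "v \<in> verts H" if "{u, v} \<in> edges H" for u v
    using that H by (auto simp: simple_graph_def)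
  have E: "{f u, f v} \<in> edges K" if "{u, v} \<in> edges H" for u v
    using e V[OF that] that by blast
  have inj: "f u = f v \<longleftrightarrow> u = v" if "u \<in> verts H" "v \<in> verts H" for u v
    using f that by (auto simp: bij_betw_def inj_on_eq_iff)
  show ?thesis
  proof (rule thin_graphI)
    fix v x y z assume *: "{v, x} \<in> edges H" "{v, y} \<in> edges H" "{v, z} \<in> edges H"
    show "x = y \<or> x = z \<or> y = z"
      using thin_graphD(1)[OF K E[OF *(1)] E[OF *(2)] E[OF *(3)]] inj V[OF *(1)] V[OF *(2)] V[OF *(3)] by blast
  next
    fix u v x y x' y'
    assume *: "{u, x} \<in> edges H" "{u, y} \<in> edges H" "x \<noteq> y"
      "{v, x'} \<in> edges H" "{v, y'} \<in> edges H" "x' \<noteq> y'" "u \<noteq> v"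
    note V' = V[OF *(1)] V[OF *(2)] V[OF *(4)] V[OF *(5)]
    have "f x \<noteq> f y" "f x' \<noteq> f y'" "f u \<noteq> f v" using inj V' * by auto
    then have "{f u, f v} \<in> edges K"
      using thin_graphD(2)[OF K E[OF *(1)] E[OF *(2)] _ E[OF *(4)] E[OF *(5)]] by blast
    then show "{u, v} \<in> edges H" using e V' by blast
  qed
qed

lemma iso_two_edges:
  assumes iso: "H \<simeq>\<^sub>g K" and V: "{a, b, c, d} \<subseteq> verts K"
    and E: "{a, b} \<in> edges K" "{c, d} \<in> edges K" "{a, b} \<noteq> {c, d}"
  shows "\<exists>e\<in>edges H. \<exists>e'\<in>edges H. e \<noteq> e'"
proof -
  obtain f where f: "bij_betw f (verts H) (verts K)"
    and e: "\<And>u v. u \<in> verts H \<Longrightarrow> v \<in> verts H \<Longrightarrow> {u, v} \<in> edges H \<longleftrightarrow> {f u, f v} \<in> edges K"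
    using iso unfolding graph_iso_def by metis
  have "\<exists>u\<in>verts H. x = f u" if "x \<in> verts K" for x
    using f that by (auto simp: bij_betw_def)
  then obtain a' b' c' d' where p: "a' \<in> verts H" "b' \<in> verts H" "c' \<in> verts H" "d' \<in> verts H"
    "a = f a'" "b = f b'" "c = f c'" "d = f d'" using V by (metis insert_subset)
  then have "{a', b'} \<in> edges H" "{c', d'} \<in> edges H" using e E by auto
  moreover have "{a', b'} \<noteq> {c', d'}" using E(3) p by (auto simp: doubleton_eq_iff)
  ultimately show ?thesis by (intro bexI)
qed

section \<open>Classification of thin graphs\<close>

text \<open>A copy of \<open>K\<close> as the subgraph of \<open>H\<close> induced on
  \<open>C\<close>. This local form of isomorphism lets the pieces of \<open>H\<close> be treated
  separately and then glued.\<close>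

definition embeds :: "('b \<Rightarrow> 'a) \<Rightarrow> 'b ugraph \<Rightarrow> 'a ugraph \<Rightarrow> 'a set \<Rightarrow> bool" where
  "embeds g K H C \<longleftrightarrow> bij_betw g (verts K) C \<and>
     (\<forall>u\<in>verts K. \<forall>v\<in>verts K. {u, v} \<in> edges K \<longleftrightarrow> {g u, g v} \<in> edges H)"

lemma embeds_verts_iso: "embeds g K H (verts H) \<Longrightarrow> H \<simeq>\<^sub>g K"
  unfolding embeds_def by (rule graph_isoI[of g]) simp_all

lemma embeds_disjoint_union:
  assumes g: "embeds g A H C" and h: "embeds h B H R" and disj: "C \<inter> R = {}"
    and cross: "\<And>u v. u \<in> C \<Longrightarrow> v \<in> R \<Longrightarrow> {u, v} \<notin> edges H"
  shows "embeds (case_sum g h) (A \<union>\<^sub>g B) H (C \<union> R)"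
  unfolding embeds_def
proof (intro conjI ballI)
  have img: "g ` verts A = C" "h ` verts B = R" and inj: "inj_on g (verts A)" "inj_on h (verts B)"
    using g h by (auto simp: embeds_def bij_betw_def)
  have V: "verts (A \<union>\<^sub>g B) = Inl ` verts A \<union> Inr ` verts B"
    by (auto simp: disjoint_union_def)
  have "inj_on (case_sum g h) (Inl ` verts A \<union> Inr ` verts B)"
  proof (rule inj_onI)
    fix p q assume pq: "p \<in> Inl ` verts A \<union> Inr ` verts B" "q \<in> Inl ` verts A \<union> Inr ` verts B"
      and eq: "case_sum g h p = case_sum g h q"
    have "g u \<noteq> h v" if "u \<in> verts A" "v \<in> verts B" for u v
      using disj img that by blast
    then show "p = q"
      using pq eq inj_onD[OF inj(1)] inj_onD[OF inj(2)] by (cases p; cases q) (fastforce simp: image_iff)+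
  qed
  moreover have "case_sum g h ` (Inl ` verts A \<union> Inr ` verts B) = C \<union> R"
    using img by (simp add: image_Un image_image)
  ultimately show "bij_betw (case_sum g h) (verts (A \<union>\<^sub>g B)) (C \<union> R)"
    by (simp add: V bij_betw_def)
  fix p q assume pq: "p \<in> verts (A \<union>\<^sub>g B)" "q \<in> verts (A \<union>\<^sub>g B)"
  have gE: "{g u, g v} \<in> edges H \<longleftrightarrow> {u, v} \<in> edges A" if "u \<in> verts A" "v \<in> verts A" for u v
    using g that by (simp add: embeds_def)
  have hE: "{h u, h v} \<in> edges H \<longleftrightarrow> {u, v} \<in> edges B" if "u \<in> verts B" "v \<in> verts B" for u v
    using h that by (simp add: embeds_def)
  have no: "{g u, h v} \<notin> edges H" "{h v, g u} \<notin> edges H" if "u \<in> verts A" "v \<in> verts B" for u v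
    using cross[of "g u" "h v"] img that by (auto simp: insert_commute)
  show "{p, q} \<in> edges (A \<union>\<^sub>g B) \<longleftrightarrow> {case_sum g h p, case_sum g h q} \<in> edges H"
    using pq unfolding V
    by (cases p; cases q) (auto simp: edges_disjoint_union gE hE no)
qed

lemma simple_edge_exists:
  assumes "simple_graph H" "e \<in> edges H"
  obtains a b where "e = {a, b}" "a \<noteq> b" "a \<in> verts H" "b \<in> verts H"
  using assms by (auto simp: simple_graph_def card_2_iff)

text \<open>No edge leaves \<open>R\<close> and degrees there are at most one, so the
  \<open>t\<close> edges inside \<open>R\<close> are disjoint pairs, and the remaining
  \<open>card R - 2 * t\<close> vertices are isolated.\<close>

lemma embeds_matching:
  assumes H: "simple_graph H" and R: "R \<subseteq> verts H"
    and closed: "\<And>u v. u \<in> R \<Longrightarrow> {u, v} \<in> edges H \<Longrightarrow> v \<in> R"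
    and matching: "\<And>u v w. u \<in> R \<Longrightarrow> {u, v} \<in> edges H \<Longrightarrow> {u, w} \<in> edges H \<Longrightarrow> v = w"
    and t: "t = card {e \<in> edges H. e \<subseteq> R}"
  shows "2 * t \<le> card R"
    and "\<exists>g. embeds g ((t \<cdot>\<^sub>g path_graph 2) \<union>\<^sub>g ((card R - 2 * t) \<cdot>\<^sub>g complete_graph 1)) H R"
proof -
  let ?E = "{e \<in> edges H. e \<subseteq> R}"
  have finR: "finite R" using H R finite_subset by (auto simp: simple_graph_def)
  have finE: "finite ?E" using finite_edges[OF H] by simp
  then obtain \<epsilon> where \<epsilon>: "bij_betw \<epsilon> {..<t} ?E"
    using ex_bij_betw_nat_finite[of ?E] t by (auto simp: atLeast0LessThan)
  have "\<exists>a b. \<epsilon> i = {a, b} \<and> a \<noteq> b" if "i < t" for i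
    using bij_betwE[OF \<epsilon>] that simple_edge_exists[OF H, of "\<epsilon> i"] by (metis (lifting) lessThan_iff mem_Collect_eq)
  then obtain a b where ab: "\<And>i. i < t \<Longrightarrow> \<epsilon> i = {a i, b i} \<and> a i \<noteq> b i" by metis
  have \<epsilon>E: "\<epsilon> i \<in> edges H \<and> \<epsilon> i \<subseteq> R" if "i < t" for i using bij_betwE[OF \<epsilon>] that by auto
  have at_x: "\<exists>y. e = {x, y}" if "e \<in> edges H" "x \<in> e" for e x
    using simple_edge_exists[OF H that(1)] that(2) by (metis insert_commute insertE singletonD)
  have same: "e = e'" if xe: "e \<in> edges H" "e' \<in> edges H" "x \<in> e" "x \<in> e'" "x \<in> R" for e e' x
  proof -
    obtain y y' where "e = {x, y}" "e' = {x, y'}"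
      using at_x[OF xe(1,3)] at_x[OF xe(2,4)] by blast
    then show ?thesis using matching[OF xe(5)] xe by metis
  qed
  \<comment> \<open>End number \<open>j\<close> of edge number \<open>i\<close>, in the coordinates
    of \<open>copies t (path_graph 2)\<close>.\<close>
  define p :: "nat \<times> nat \<Rightarrow> 'a" where "p = (\<lambda>(i, j). if j = 0 then a i else b i)"
  have p_in: "p (i, j) \<in> \<epsilon> i" if "i < t" for i j using ab[OF that] by (auto simp: p_def)
  have p_R: "p (i, j) \<in> R" if "i < t" for i j using p_in[OF that] \<epsilon>E[OF that] by blast
  have \<epsilon>_eq: "i = i'" if "i < t" "i' < t" "p (i, j) \<in> \<epsilon> i'" for i i' j
  proof -
    have "\<epsilon> i = \<epsilon> i'" using same \<epsilon>E that p_in p_R by blast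
    then show ?thesis using \<epsilon> that by (auto simp: bij_betw_def inj_on_def)
  qed
  let ?M = "p ` ({..<t} \<times> {..<2})"
  have two: "j < 2 \<longleftrightarrow> j = 0 \<or> j = (1::nat)" for j by auto
  have inj_p: "inj_on p ({..<t} \<times> {..<2})"
  proof (rule inj_onI)
    fix x y assume "x \<in> {..<t} \<times> {..<2::nat}" "y \<in> {..<t} \<times> {..<2::nat}" and eq: "p x = p y"
    then obtain i j i' j' where x: "x = (i, j)" "i < t" "j < 2" and y: "y = (i', j')" "i' < t" "j' < 2"
      by auto
    have "p (i, j) \<in> \<epsilon> i'" using eq x(1) y(1) p_in[OF y(2), of j'] by simp
    then have "i = i'" by (rule \<epsilon>_eq[OF x(2) y(2)])
    then show "x = y" using eq x y ab[OF x(2)] by (auto simp: p_def two split: if_splits)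
  qed
  have M_R: "?M \<subseteq> R" using p_R by auto
  have card_M: "card ?M = 2 * t" using card_image[OF inj_p] by simp
  then show "2 * t \<le> card R" using card_mono[OF finR M_R] by simp
  have card_I: "card (R - ?M) = card R - 2 * t"
    using card_M M_R finR by (simp add: card_Diff_subset finite_subset)
  have touched: "x \<in> ?M" if "x \<in> R" "{x, y} \<in> edges H" for x y
  proof -
    have "{x, y} \<in> ?E" using that closed by auto
    then have "{x, y} \<in> \<epsilon> ` {..<t}" using \<epsilon> by (simp add: bij_betw_def)
    then obtain i where i: "i < t" "{x, y} = \<epsilon> i" by auto
    then have "x \<in> \<epsilon> i" by blast
    then have "x = a i \<or> x = b i" using ab[OF i(1)] by simp
    then have "x = p (i, 0) \<or> x = p (i, 1)" by (simp add: p_def)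
    moreover have "(i, 0) \<in> {..<t} \<times> {..<2::nat}" "(i, 1) \<in> {..<t} \<times> {..<2::nat}" using i(1) by simp_all
    ultimately show ?thesis by (metis imageI)
  qed
  have emb_p: "embeds p (t \<cdot>\<^sub>g path_graph 2) H ?M"
    unfolding embeds_def
  proof (intro conjI ballI)
    have V: "verts (t \<cdot>\<^sub>g path_graph 2) = {..<t} \<times> {..<2}" by (simp add: copies_def path_graph_def)
    show "bij_betw p (verts (t \<cdot>\<^sub>g path_graph 2)) ?M" using inj_p by (simp add: V bij_betw_def)
    fix x y assume "x \<in> verts (t \<cdot>\<^sub>g path_graph 2)" "y \<in> verts (t \<cdot>\<^sub>g path_graph 2)"
    then obtain i j i' j' where x: "x = (i, j)" "i < t" "j < 2" and y: "y = (i', j')" "i' < t" "j' < 2"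
      by (auto simp: V)
    show "{x, y} \<in> edges (t \<cdot>\<^sub>g path_graph 2) \<longleftrightarrow> {p x, p y} \<in> edges H"
    proof
      assume "{x, y} \<in> edges (t \<cdot>\<^sub>g path_graph 2)"
      then have "i' = i" "j = Suc j' \<or> j' = Suc j" using x y by (auto simp: edges_copies edges_path_graph)
      then have "{p x, p y} = {a i, b i}" using x y by (auto simp: p_def two)
      then show "{p x, p y} \<in> edges H" using ab[OF x(2)] \<epsilon>E[OF x(2)] by simp
    next
      assume e: "{p x, p y} \<in> edges H"
      then have "p x \<noteq> p y" using H by (auto simp: simple_graph_def)
      have "{p x, p y} = \<epsilon> i" using same[OF e] \<epsilon>E[OF x(2)] p_in[OF x(2)] p_R[OF x(2)] x(1) by blast
      then have "i' = i" using \<epsilon>_eq[OF y(2) x(2), of j'] y(1) by auto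
      then have "j \<noteq> j'" using \<open>p x \<noteq> p y\<close> x(1) y(1) by auto
      then show "{x, y} \<in> edges (t \<cdot>\<^sub>g path_graph 2)"
        using x y \<open>i' = i\<close> by (auto simp: edges_copies edges_path_graph)
    qed
  qed
  obtain q where q: "bij_betw q {..<card R - 2 * t} (R - ?M)"
    using ex_bij_betw_nat_finite[of "R - ?M"] finR card_I by (auto simp: atLeast0LessThan)
  \<comment> \<open>A vertex in the copies of a single point is a pair \<open>(i, 0)\<close>, so
    \<open>fst\<close> recovers the index that \<open>q\<close> enumerates.\<close>
  have emb_q: "embeds (q \<circ> fst) ((card R - 2 * t) \<cdot>\<^sub>g complete_graph 1) H (R - ?M)"
    unfolding embeds_def
  proof (intro conjI ballI)
    have V: "verts ((card R - 2 * t) \<cdot>\<^sub>g complete_graph 1) = {..<card R - 2 * t} \<times> {0}"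
      by (auto simp: copies_def complete_graph_def)
    have "bij_betw fst ({..<card R - 2 * t} \<times> {0::nat}) {..<card R - 2 * t}"
      by (auto simp: bij_betw_def inj_on_def)
    then show B: "bij_betw (q \<circ> fst) (verts ((card R - 2 * t) \<cdot>\<^sub>g complete_graph 1)) (R - ?M)"
      using q unfolding V by (rule bij_betw_trans)
    fix x y
    assume "x \<in> verts ((card R - 2 * t) \<cdot>\<^sub>g complete_graph 1)" "y \<in> verts ((card R - 2 * t) \<cdot>\<^sub>g complete_graph 1)"
    then have "(q \<circ> fst) x \<in> R - ?M" using bij_betwE[OF B] by blast
    then have "{(q \<circ> fst) x, (q \<circ> fst) y} \<notin> edges H" using touched by blast
    then show "{x, y} \<in> edges ((card R - 2 * t) \<cdot>\<^sub>g complete_graph 1) \<longleftrightarrow>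
      {(q \<circ> fst) x, (q \<circ> fst) y} \<in> edges H"
      by (auto simp: edges_copies edges_complete_graph)
  qed
  have "{u, v} \<notin> edges H" if "u \<in> ?M" "v \<in> R - ?M" for u v
  proof
    assume "{u, v} \<in> edges H"
    then have "{v, u} \<in> edges H" by (simp add: insert_commute)
    then show False using touched that(2) by blast
  qed
  from embeds_disjoint_union[OF emb_p emb_q _ this]
  have "embeds (case_sum p (q \<circ> fst))
    ((t \<cdot>\<^sub>g path_graph 2) \<union>\<^sub>g ((card R - 2 * t) \<cdot>\<^sub>g complete_graph 1)) H (?M \<union> (R - ?M))" by blast
  moreover have "?M \<union> (R - ?M) = R" using M_R by blast
  ultimately show "\<exists>g. embeds g ((t \<cdot>\<^sub>g path_graph 2) \<union>\<^sub>g ((card R - 2 * t) \<cdot>\<^sub>g complete_graph 1)) H R"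
    by metis
qed

text \<open>The list \<open>cs\<close> numbers the vertices of the core, so \<open>(!) cs\<close>
  embeds the model \<open>A\<close>. No edge leaves the core, so none enters it, and
  \<open>embeds_matching\<close> describes the rest.\<close>

lemma core_iso:
  assumes H: "simple_graph H" and cs: "distinct cs" "set cs \<subseteq> verts H"
    and A: "verts A = {..<length cs}"
      "\<And>i j. i < length cs \<Longrightarrow> j < length cs \<Longrightarrow> {i, j} \<in> edges A \<longleftrightarrow> {cs ! i, cs ! j} \<in> edges H"
    and closed: "\<And>u v. u \<in> set cs \<Longrightarrow> {u, v} \<in> edges H \<Longrightarrow> v \<in> set cs"
    and matching: "\<And>u v w. u \<notin> set cs \<Longrightarrow> {u, v} \<in> edges H \<Longrightarrow> {u, w} \<in> edges H \<Longrightarrow> v = w"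
  shows "\<exists>t. 2 * t + length cs \<le> card (verts H) \<and>
    H \<simeq>\<^sub>g A \<union>\<^sub>g (t \<cdot>\<^sub>g path_graph 2) \<union>\<^sub>g ((card (verts H) - 2 * t - length cs) \<cdot>\<^sub>g complete_graph 1)"
proof -
  let ?R = "verts H - set cs"
  define t where "t = card {e \<in> edges H. e \<subseteq> ?R}"
  have closed': "v \<in> ?R" if "u \<in> ?R" "{u, v} \<in> edges H" for u v
    using that H closed[of v u] by (auto simp: insert_commute simple_graph_def)
  have fin: "finite (verts H)" using H by (simp add: simple_graph_def)
  have card_R: "card ?R = card (verts H) - length cs" "length cs \<le> card (verts H)"
    using card_Diff_subset[OF _ cs(2)] card_mono[OF fin cs(2)] distinct_card[OF cs(1)] by simp_all
  have matching': "v = w" if "u \<in> ?R" "{u, v} \<in> edges H" "{u, w} \<in> edges H" for u v w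
    using matching[of u v w] that by simp
  note M = embeds_matching[OF H Diff_subset closed' matching' t_def]
  have le: "2 * t \<le> card ?R" by (rule M(1))
  obtain g where g: "embeds g ((t \<cdot>\<^sub>g path_graph 2) \<union>\<^sub>g ((card ?R - 2 * t) \<cdot>\<^sub>g complete_graph 1)) H ?R"
    using M(2) by (rule exE)
  have "embeds ((!) cs) A H (set cs)"
    unfolding embeds_def
    using bij_betw_nth[OF cs(1), of "{..<length cs}" "set cs"] A by simp
  from embeds_disjoint_union[OF this g]
  have "embeds (case_sum ((!) cs) g)
    (A \<union>\<^sub>g (t \<cdot>\<^sub>g path_graph 2) \<union>\<^sub>g ((card ?R - 2 * t) \<cdot>\<^sub>g complete_graph 1)) H (set cs \<union> ?R)"
    using closed by blast
  moreover have "set cs \<union> ?R = verts H" using cs(2) by blast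
  moreover have "card ?R - 2 * t = card (verts H) - 2 * t - length cs" using card_R by simp
  ultimately have "H \<simeq>\<^sub>g A \<union>\<^sub>g (t \<cdot>\<^sub>g path_graph 2) \<union>\<^sub>g
      ((card (verts H) - 2 * t - length cs) \<cdot>\<^sub>g complete_graph 1)"
    by (metis embeds_verts_iso)
  then show ?thesis using le card_R by (intro exI[of _ t]) simp
qed

text \<open>This serves the three families with a core: the core is thin and already contains the
  two required edges.\<close>

lemma thin_union_pairs_points_iso:
  assumes "H \<simeq>\<^sub>g A \<union>\<^sub>g (t \<cdot>\<^sub>g path_graph 2) \<union>\<^sub>g (k \<cdot>\<^sub>g complete_graph 1)" "simple_graph H" "thin_graph A"
    and "{a, b, c, d} \<subseteq> verts A" "{a, b} \<in> edges A" "{c, d} \<in> edges A" "{a, b} \<noteq> {c, d}"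
  shows "thin_graph H \<and> (\<exists>e\<in>edges H. \<exists>e'\<in>edges H. e \<noteq> e')"
proof
  show "thin_graph H"
    using iso_thin[OF assms(1,2)] thin_disjoint_union[OF assms(3) matching_pairs_and_points] by blast
  show "\<exists>e\<in>edges H. \<exists>e'\<in>edges H. e \<noteq> e'"
  proof (rule iso_two_edges[OF assms(1), of "Inl a" "Inl b" "Inl c" "Inl d"])
    show "{Inl a, Inl b, Inl c, Inl d} \<subseteq> verts (A \<union>\<^sub>g (t \<cdot>\<^sub>g path_graph 2) \<union>\<^sub>g (k \<cdot>\<^sub>g complete_graph 1))"
      using assms(4) by (simp add: disjoint_union_def InlI)
  qed (use assms in \<open>auto simp: edges_disjoint_union doubleton_eq_iff\<close>)
qed

text \<open>From left to right, a vertex \<open>u\<close> with neighbours \<open>x\<close> and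
  \<open>y\<close> decides: whether \<open>x\<close> and \<open>y\<close> are adjacent, and whether
  one of them has a further neighbour, selects the family; without such a vertex there is a
  matching. The bounds on \<open>s\<close> and \<open>t\<close> are integers, so that
  \<open>n = 3\<close> admits no \<open>s\<close>, where a truncated \<open>n - 4\<close> would
  admit 0.\<close>

lemma thin_two_edges_iff:
  assumes H: "simple_graph H" and n: "card (verts H) = n"
  shows "thin_graph H \<and> (\<exists>e\<in>edges H. \<exists>e'\<in>edges H. e \<noteq> e') \<longleftrightarrow>
    (\<exists>r::nat. 2 \<le> r \<and> r \<le> n div 2 \<and>
       H \<simeq>\<^sub>g (r \<cdot>\<^sub>g path_graph 2) \<union>\<^sub>g ((n - 2 * r) \<cdot>\<^sub>g complete_graph 1)) \<or>
    (\<exists>s::nat. int s \<le> (int n - 4) div 2 \<and>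
       H \<simeq>\<^sub>g path_graph 4 \<union>\<^sub>g (s \<cdot>\<^sub>g path_graph 2) \<union>\<^sub>g ((n - 2 * s - 4) \<cdot>\<^sub>g complete_graph 1)) \<or>
    (\<exists>t::nat. int t \<le> (int n - 3) div 2 \<and>
       H \<simeq>\<^sub>g path_graph 3 \<union>\<^sub>g (t \<cdot>\<^sub>g path_graph 2) \<union>\<^sub>g ((n - 2 * t - 3) \<cdot>\<^sub>g complete_graph 1)) \<or>
    (\<exists>t::nat. int t \<le> (int n - 3) div 2 \<and>
       H \<simeq>\<^sub>g cycle_graph 3 \<union>\<^sub>g (t \<cdot>\<^sub>g path_graph 2) \<union>\<^sub>g ((n - 2 * t - 3) \<cdot>\<^sub>g complete_graph 1))"
    (is "?L \<longleftrightarrow> ?R1 \<or> ?R2 \<or> ?R3 \<or> ?R4")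
proof
  assume "?R1 \<or> ?R2 \<or> ?R3 \<or> ?R4"
  then show ?L
  proof (elim disjE exE conjE)
    fix r :: nat
    assume r: "2 \<le> r"
      and iso: "H \<simeq>\<^sub>g (r \<cdot>\<^sub>g path_graph 2) \<union>\<^sub>g ((n - 2 * r) \<cdot>\<^sub>g complete_graph 1)"
    have "thin_graph H"
      using iso_thin[OF iso H] matching_imp_thin[OF matching_pairs_and_points] by blast
    moreover have "\<exists>e\<in>edges H. \<exists>e'\<in>edges H. e \<noteq> e'"
    proof (rule iso_two_edges[OF iso, of "Inl (0, 0)" "Inl (0, 1)" "Inl (1, 0)" "Inl (1, 1)"])
      show "{Inl (0, 0), Inl (0, 1), Inl (1, 0), Inl (1, 1)} \<subseteq>
        verts ((r \<cdot>\<^sub>g path_graph 2) \<union>\<^sub>g ((n - 2 * r) \<cdot>\<^sub>g complete_graph 1))"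
        using r by (auto simp: disjoint_union_def copies_def path_graph_def)
    qed (use r in \<open>auto simp: edges_disjoint_union edges_copies edges_path_graph doubleton_eq_iff\<close>)
    ultimately show ?L by blast
  next
    fix s assume "H \<simeq>\<^sub>g path_graph 4 \<union>\<^sub>g (s \<cdot>\<^sub>g path_graph 2) \<union>\<^sub>g ((n - 2 * s - 4) \<cdot>\<^sub>g complete_graph 1)"
    then show ?L
      by (rule thin_union_pairs_points_iso[where a = 0 and b = 1 and c = 1 and d = 2])
        (use H thin_path_graph[of 4] in \<open>auto simp: edges_path_graph path_graph_def doubleton_eq_iff\<close>)
  next
    fix t assume "H \<simeq>\<^sub>g path_graph 3 \<union>\<^sub>g (t \<cdot>\<^sub>g path_graph 2) \<union>\<^sub>g ((n - 2 * t - 3) \<cdot>\<^sub>g complete_graph 1)"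
    then show ?L
      by (rule thin_union_pairs_points_iso[where a = 0 and b = 1 and c = 1 and d = 2])
        (use H thin_path_graph[of 3] in \<open>auto simp: edges_path_graph path_graph_def doubleton_eq_iff\<close>)
  next
    fix t assume "H \<simeq>\<^sub>g cycle_graph 3 \<union>\<^sub>g (t \<cdot>\<^sub>g path_graph 2) \<union>\<^sub>g ((n - 2 * t - 3) \<cdot>\<^sub>g complete_graph 1)"
    then show ?L
      by (rule thin_union_pairs_points_iso[where a = 0 and b = 1 and c = 1 and d = 2])
        (use H thin_cycle_graph_3 in \<open>auto simp: edges_cycle_graph_3 cycle_graph_def doubleton_eq_iff\<close>)
  qed
next
  assume L: ?L
  then obtain e e' where ee: "e \<in> edges H" "e' \<in> edges H" "e \<noteq> e'" by blast
  have "thin_graph H" using L by blast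
  note deg_le_2 = thin_graphD(1)[OF this] and deg_2_adjacent = thin_graphD(2)[OF this]
  have V: "u \<in> verts H \<and> v \<in> verts H \<and> u \<noteq> v" if "{u, v} \<in> edges H" for u v
    using that H by (auto simp: simple_graph_def)
  have sym: "{v, u} \<in> edges H" if "{u, v} \<in> edges H" for u v
    using that by (simp add: insert_commute)
  show "?R1 \<or> ?R2 \<or> ?R3 \<or> ?R4"
  proof (cases "\<exists>u x y. {u, x} \<in> edges H \<and> {u, y} \<in> edges H \<and> x \<noteq> y")
    case False
    define r where "r = card {e \<in> edges H. e \<subseteq> verts H}"
    have "v \<in> verts H" if "u \<in> verts H" "{u, v} \<in> edges H" for u v using V that by blast
    moreover have "v = w" if "u \<in> verts H" "{u, v} \<in> edges H" "{u, w} \<in> edges H" for u v w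
      using False that by blast
    ultimately have M: "2 * r \<le> n"
      "\<exists>g. embeds g ((r \<cdot>\<^sub>g path_graph 2) \<union>\<^sub>g ((n - 2 * r) \<cdot>\<^sub>g complete_graph 1)) H (verts H)"
      using embeds_matching[OF H order_refl _ _ r_def] by (simp_all add: n)
    have "card {e, e'} \<le> r"
      unfolding r_def using ee H finite_edges[OF H] by (intro card_mono) (auto simp: simple_graph_def)
    then have "2 \<le> r" using ee(3) by simp
    moreover have "H \<simeq>\<^sub>g (r \<cdot>\<^sub>g path_graph 2) \<union>\<^sub>g ((n - 2 * r) \<cdot>\<^sub>g complete_graph 1)"
      using M(2) embeds_verts_iso by blast
    moreover have "r \<le> n div 2" using M(1) by simp
    ultimately have ?R1 by blast
    then show ?thesis by blast
  next
    case True
    then obtain u x y where u: "{u, x} \<in> edges H" "{u, y} \<in> edges H" "x \<noteq> y" by blast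
    have ux: "u \<noteq> x" "u \<noteq> y" and uV: "u \<in> verts H" "x \<in> verts H" "y \<in> verts H"
      using V[OF u(1)] V[OF u(2)] by auto
    have Nu: "{u, w} \<in> edges H \<longleftrightarrow> w = x \<or> w = y" for w
      using deg_le_2[OF u(1,2), of w] u by blast
    \<comment> \<open>Any other vertex of degree two is adjacent to \<open>u\<close>, hence is
      \<open>x\<close> or \<open>y\<close>.\<close>
    have only: "v = w" if "{p, v} \<in> edges H" "{p, w} \<in> edges H" "p \<noteq> u" "p \<noteq> x" "p \<noteq> y" for p v w
    proof (rule ccontr)
      assume "v \<noteq> w"
      from deg_2_adjacent[OF u that(1,2) this that(3)[symmetric]] show False using Nu[of p] that by blast
    qed
    \<comment> \<open>General in \<open>x\<close> and \<open>y\<close>, so that it also applies with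
      the two exchanged. The path is \<open>y\<close>, \<open>u\<close>, \<open>x\<close>,
      \<open>z\<close>. A further neighbour of \<open>y\<close> would give \<open>x\<close> and
      \<open>y\<close> degree two and so make them adjacent; \<open>z\<close> has only
      \<open>x\<close> as neighbour by \<open>only\<close>.\<close>
    have P4: ?R2 if xy: "{u, x} \<in> edges H" "{u, y} \<in> edges H" "x \<noteq> y" "{x, y} \<notin> edges H"
      and z: "{x, z} \<in> edges H" "z \<noteq> u" and Nu: "\<And>w. {u, w} \<in> edges H \<longleftrightarrow> w = x \<or> w = y"
      and only: "\<And>p v w. {p, v} \<in> edges H \<Longrightarrow> {p, w} \<in> edges H \<Longrightarrow> p \<noteq> u \<Longrightarrow> p \<noteq> x \<Longrightarrow> p \<noteq> y \<Longrightarrow> v = w"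
      for x y z
    proof -
      have xu: "{x, u} \<in> edges H" "{y, u} \<in> edges H" using xy sym by blast+
      have ne: "u \<noteq> x" "u \<noteq> y" "x \<noteq> z" "z \<noteq> y" "z \<in> verts H" "u \<in> verts H" "x \<in> verts H" "y \<in> verts H"
        using V[OF xy(1)] V[OF xy(2)] V[OF z(1)] z xy(4) by auto
      have Nx: "{x, w} \<in> edges H \<longleftrightarrow> w = u \<or> w = z" for w
        using deg_le_2[OF xu(1) z(1), of w] xu z by blast
      have Ny: "{y, w} \<in> edges H \<longleftrightarrow> w = u" for w
      proof
        assume w: "{y, w} \<in> edges H"
        show "w = u"
        proof (rule ccontr)
          assume "w \<noteq> u"
          then have "u \<noteq> w" by simp
          from deg_2_adjacent[OF xu(1) z(1) z(2)[symmetric] xu(2) w this xy(3)]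
          show False using xy(4) by simp
        qed
      qed (use xu in simp)
      have zx: "{z, x} \<in> edges H" using z(1) by (rule sym)
      have Nz: "{z, w} \<in> edges H \<longleftrightarrow> w = x" for w
        using only[OF zx, of w] zx z(2) ne by blast
      have len: "length [y, u, x, z] = 4" by simp
      have "\<exists>s. 2 * s + length [y, u, x, z] \<le> card (verts H) \<and> H \<simeq>\<^sub>g path_graph 4 \<union>\<^sub>g (s \<cdot>\<^sub>g path_graph 2)
        \<union>\<^sub>g ((card (verts H) - 2 * s - length [y, u, x, z]) \<cdot>\<^sub>g complete_graph 1)"
      proof (rule core_iso[OF H])
        show "distinct [y, u, x, z]" "set [y, u, x, z] \<subseteq> verts H" using ne xy z by auto
        show "verts (path_graph 4) = {..<length [y, u, x, z]}" by (simp add: path_graph_def)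
        have lt: "i < 4 \<longleftrightarrow> i = 0 \<or> i = 1 \<or> i = 2 \<or> i = 3" for i :: nat by auto
        show "{i, j} \<in> edges (path_graph 4) \<longleftrightarrow> {[y, u, x, z] ! i, [y, u, x, z] ! j} \<in> edges H"
          if "i < length [y, u, x, z]" "j < length [y, u, x, z]" for i j
        proof -
          have "i < 4" "j < 4" using that by simp_all
          then show ?thesis
            unfolding lt
            by (elim disjE) (use ne(1-4) xy(3) z(2) in \<open>simp_all add: edges_path_graph Nu Nx Ny Nz del: insert_absorb2\<close>)
        qed
        show "v \<in> set [y, u, x, z]" if "p \<in> set [y, u, x, z]" "{p, v} \<in> edges H" for p v
          using that by (auto simp: Nu Nx Ny Nz)
        show "v = w" if "p \<notin> set [y, u, x, z]" "{p, v} \<in> edges H" "{p, w} \<in> edges H" for p v w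
          using only[OF that(2,3)] that(1) by simp
      qed
      then obtain s where s: "2 * s + 4 \<le> n" "H \<simeq>\<^sub>g path_graph 4 \<union>\<^sub>g (s \<cdot>\<^sub>g path_graph 2)
        \<union>\<^sub>g ((n - 2 * s - 4) \<cdot>\<^sub>g complete_graph 1)" unfolding len n by blast
      then have "int s \<le> (int n - 4) div 2" by linarith
      then show ?R2 using s(2) by blast
    qed
    \<comment> \<open>Shared by the triangle and the P3: in both, \<open>x\<close> and
      \<open>y\<close> have no neighbour outside the core.\<close>
    have core3: "\<exists>t::nat. int t \<le> (int n - 3) div 2 \<and>
        H \<simeq>\<^sub>g A \<union>\<^sub>g (t \<cdot>\<^sub>g path_graph 2) \<union>\<^sub>g ((n - 2 * t - 3) \<cdot>\<^sub>g complete_graph 1)"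
      if A: "verts A = {..<3}"
        "\<And>i j. i < 3 \<Longrightarrow> j < 3 \<Longrightarrow> {i, j} \<in> edges A \<longleftrightarrow> {[x, u, y] ! i, [x, u, y] ! j} \<in> edges H"
        and Nx: "\<And>w. {x, w} \<in> edges H \<Longrightarrow> w = u \<or> w = y"
        and Ny: "\<And>w. {y, w} \<in> edges H \<Longrightarrow> w = u \<or> w = x" for A
    proof -
      have len: "length [x, u, y] = 3" by simp
      have "\<exists>t. 2 * t + length [x, u, y] \<le> card (verts H) \<and> H \<simeq>\<^sub>g A \<union>\<^sub>g (t \<cdot>\<^sub>g path_graph 2)
        \<union>\<^sub>g ((card (verts H) - 2 * t - length [x, u, y]) \<cdot>\<^sub>g complete_graph 1)"
      proof (rule core_iso[OF H])
        show "distinct [x, u, y]" "set [x, u, y] \<subseteq> verts H" using ux uV u(3) by auto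
        show "verts A = {..<length [x, u, y]}" using A(1) by simp
        show "{i, j} \<in> edges A \<longleftrightarrow> {[x, u, y] ! i, [x, u, y] ! j} \<in> edges H"
          if "i < length [x, u, y]" "j < length [x, u, y]" for i j
          using A(2) that by simp
        show "v \<in> set [x, u, y]" if "p \<in> set [x, u, y]" "{p, v} \<in> edges H" for p v
          using that Nx[of v] Ny[of v] by (auto simp: Nu)
        show "v = w" if "p \<notin> set [x, u, y]" "{p, v} \<in> edges H" "{p, w} \<in> edges H" for p v w
          using only[OF that(2,3)] that(1) by simp
      qed
      then obtain t where t: "2 * t + 3 \<le> n" "H \<simeq>\<^sub>g A \<union>\<^sub>g (t \<cdot>\<^sub>g path_graph 2)
        \<union>\<^sub>g ((n - 2 * t - 3) \<cdot>\<^sub>g complete_graph 1)" unfolding len n by blast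
      then have "int t \<le> (int n - 3) div 2" by linarith
      then show ?thesis using t(2) by blast
    qed
    have less_3: "i < 3 \<longleftrightarrow> i = 0 \<or> i = 1 \<or> i = 2" for i :: nat by auto
    have xu: "{x, u} \<in> edges H" "{y, u} \<in> edges H" using u sym by blast+
    show ?thesis
    proof (cases "{x, y} \<in> edges H")
      case xy: True
      have Nx: "{x, w} \<in> edges H \<longleftrightarrow> w = u \<or> w = y" for w
        using deg_le_2[OF xu(1) xy, of w] xu xy ux by blast
      have yx: "{y, x} \<in> edges H" using xy by (rule sym)
      have Ny: "{y, w} \<in> edges H \<longleftrightarrow> w = u \<or> w = x" for w
        using deg_le_2[OF xu(2) yx, of w] xu yx ux by blast
      have ?R4
      proof (rule core3)
        show "verts (cycle_graph 3) = {..<3}" by (simp add: cycle_graph_def)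
        show "{i, j} \<in> edges (cycle_graph 3) \<longleftrightarrow> {[x, u, y] ! i, [x, u, y] ! j} \<in> edges H"
          if "i < 3" "j < 3" for i j
          using that unfolding less_3
          by (elim disjE) (use ux u(3) in \<open>simp_all add: edges_cycle_graph_3 Nu Nx Ny del: insert_absorb2\<close>)
      qed (simp_all add: Nx Ny)
      then show ?thesis by blast
    next
      case xy: False
      show ?thesis
      proof (cases "\<exists>z. {x, z} \<in> edges H \<and> z \<noteq> u")
        case True
        then obtain z where z: "{x, z} \<in> edges H" "z \<noteq> u" by blast
        have ?R2 by (rule P4[OF u xy z Nu]) (erule (4) only)
        then show ?thesis by blast
      next
        case nx: False
        show ?thesis
        proof (cases "\<exists>z. {y, z} \<in> edges H \<and> z \<noteq> u")
          case True
          then obtain z where z: "{y, z} \<in> edges H" "z \<noteq> u" by blast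
          have yx: "{y, x} \<notin> edges H" using xy sym by blast
          have Nu': "{u, w} \<in> edges H \<longleftrightarrow> w = y \<or> w = x" for w using Nu by blast
          have only': "v = w" if "{p, v} \<in> edges H" "{p, w} \<in> edges H" "p \<noteq> u" "p \<noteq> y" "p \<noteq> x" for p v w
            by (rule only[OF that(1-3,5,4)])
          have ?R2 by (rule P4[OF u(2,1) u(3)[symmetric] yx z Nu']) (erule (4) only')
          then show ?thesis by blast
        next
          case ny: False
          have Nx: "{x, w} \<in> edges H \<longleftrightarrow> w = u" for w using nx xu by blast
          have Ny: "{y, w} \<in> edges H \<longleftrightarrow> w = u" for w using ny xu by blast
          have ?R3
          proof (rule core3)
            show "verts (path_graph 3) = {..<3}" by (simp add: path_graph_def)
            show "{i, j} \<in> edges (path_graph 3) \<longleftrightarrow> {[x, u, y] ! i, [x, u, y] ! j} \<in> edges H"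
              if "i < 3" "j < 3" for i j
              using that unfolding less_3
              by (elim disjE) (use ux u(3) in \<open>simp_all add: edges_path_graph Nu Nx Ny del: insert_absorb2\<close>)
          qed (simp_all add: Nx Ny)
          then show ?thesis by blast
        qed
      qed
    qed
  qed
qed

theorem theorem2:
  fixes G :: "'a ugraph" and n :: nat
  assumes "simple_graph G"
    and "connected_graph G"
    and "card (verts G) = n"
    and "n \<ge> 3"
  shows "gen_lambda 3 G = n - 3 \<longleftrightarrow>
    (\<exists>r::nat. 2 \<le> r \<and> r \<le> n div 2 \<and>
       complement G \<simeq>\<^sub>g (r \<cdot>\<^sub>g path_graph 2) \<union>\<^sub>g ((n - 2 * r) \<cdot>\<^sub>g complete_graph 1)) \<or>
    (\<exists>s::nat. int s \<le> (int n - 4) div 2 \<and>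
       complement G \<simeq>\<^sub>g path_graph 4 \<union>\<^sub>g (s \<cdot>\<^sub>g path_graph 2) \<union>\<^sub>g ((n - 2 * s - 4) \<cdot>\<^sub>g complete_graph 1)) \<or>
    (\<exists>t::nat. int t \<le> (int n - 3) div 2 \<and>
       complement G \<simeq>\<^sub>g path_graph 3 \<union>\<^sub>g (t \<cdot>\<^sub>g path_graph 2) \<union>\<^sub>g ((n - 2 * t - 3) \<cdot>\<^sub>g complete_graph 1)) \<or>
    (\<exists>t::nat. int t \<le> (int n - 3) div 2 \<and>
       complement G \<simeq>\<^sub>g cycle_graph 3 \<union>\<^sub>g (t \<cdot>\<^sub>g path_graph 2) \<union>\<^sub>g ((n - 2 * t - 3) \<cdot>\<^sub>g complete_graph 1))"
proof -
  have "simple_graph (complement G)"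
    using assms(1) by (simp add: simple_graph_def complement_def)
  moreover have "card (verts (complement G)) = n"
    using assms(3) by (simp add: complement_def)
  ultimately show ?thesis
    using gen_lambda_3_eq_iff[OF assms(1,2)] assms(3,4) thin_two_edges_iff by simp
qed

end
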